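(* Let $G$ be a group acting geometrically on a proper metric space $X$ that admits a consistent, conical, $G$-equivariant bicombing $\sigma$. Let $\overline X_\sigma=X\cup\partial_\sigma X$ be the compactification of $X$ by classes of $\sigma$-rays, and let $\overline X^{\Sigma'}$ be a compactification of $X$ obtained via the Gelfand dual construction from a combing $\Sigma'$ of $X$ arising by the procedure described in the context. Then there exists a $G$-equivariant homeomorphism $\tau\colon\overline X_\sigma\to\overline X^{\Sigma'}$ fixing the copies of $X$ in $\overline X_\sigma$ and $\overline X^{\Sigma'}$ pointwise, i.e. $\tau(x)=\delta_x$ for all $x\in X$.
   Context: Proper means closed balls are compact. An action via isometries is geometric if $\{g: gK\cap K\ne\emptyset\}$ is finite for every compact $K$ and $G\backslash X$ is compact. A (geodesic) bicombing on a geodesic metric space $(X,d)$ is a continuous map $\sigma\colon X\times X\times[0,1]\to X$ such that each $\sigma_{xy}:=\sigma(x,y,\cdot)$ is a constant speed geodesic from $x$ to $y$. It is consistent if $\operatorname{im}\sigma_{\sigma_{xy}(s),\sigma_{xy}(t)}=\operatorname{im}\sigma_{xy}|_{[s,t]}$ for all $x,y$ and $0\le s<t\le1$; conical if $d(\sigma_{xy}(t),\sigma_{x'y'}(t))\le(1-t)d(x,x')+t\,d(y,y')$ always; $G$-equivariant if $g\sigma_{xy}=\sigma_{gx,gy}$ for all $g\in G$. Compactification $\overline X_\sigma$: a $\sigma$-ray is an isometric embedding $\xi\colon[0,\infty)\to X$ with $\operatorname{im}\sigma_{\xi(0)\xi(t)}=\operatorname{im}\xi|_{[0,t]}$ for all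 $t\ge0$; $\sigma$-rays $\xi,\zeta$ are asymptotic if $\sup_td(\xi(t),\zeta(t))<\infty$; $\partial_\sigma X$ is the set of asymptoty classes $[\xi]$ and $\overline X_\sigma=X\cup\partial_\sigma X$. For $o\in X$, $\bar x\in\partial_\sigma X$, $\varrho_{o,\bar x}$ is the unique $\sigma$-ray in $\bar x$ starting at $o$; for $x\in X$, $\varrho_{o,x}(t)=\sigma_{ox}(\min(t/d(o,x),1))$ (constant if $x=o$). The topology has base $U_o(\bar x,t,\epsilon)=\{\bar y\in\overline X_\sigma:d(\varrho_{o,\bar y}(t),\varrho_{o,\bar x}(t))<\epsilon\}$ ($\bar x\in\overline X_\sigma$, $t\ge0$, $\epsilon>0$), for fixed $o$ (independent of $o$). $G$ acts on $\overline X_\sigma$ by extending its action on $X$ via $g[\xi]=[g\xi]$. Combings: a combing of a metric space $(Y,d_Y)$ with basepoint $o$ is a map $\Sigma\colon Y\times\mathbb N\to Y$, $\Sigma_n(y)=\Sigma(y,n)$, such that $\Sigma_n(o)=o=\Sigma_0(y)$ for all $y,n$; for every $R\ge0$ there is $N$ with $\Sigma_n(y)=y$ for all $n\ge N$ and $y\in\overline B(o,R)$; and for every $D>0$ there is $C$ with $d_Y(\Sigma(y,n),\Sigma(y',n'))\le C$ whenever $d_Y(y,y')\le D$, $|n-n'|\le D$. A map $\alpha\colon Y_1\to Y_2$ is a morphism $(Y_1,\Sigma_1)\to(Y_2,\Sigma_2)$ if $(y,n)\mapsto d_{Y_2}(\alpha(\Sigma_1(y,n)),\Sigma_2(\alpha(y),n))$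 is bounded. Procedure giving $\Sigma'$: fix $o\in X$ and put $\Sigma(x,n):=\varrho_{o,x}(n)$. $G$ is finitely generated; equip it with a word metric. Let $\alpha\colon G\to X$, $\alpha(g)=go$ (a quasi-isometry), let $\beta\colon X\to G$ be a quasi-inverse of $\alpha$, and put $\Sigma_G(g,n):=\beta(\Sigma(\alpha(g),n))$. Let $\alpha'\colon G\to X$ be $\alpha'(g)=gx_0$ for some $x_0\in X$, and let $\Sigma'$ be a combing on $X$ such that $\alpha'$ is a morphism from $(G,\Sigma_G)$ to $(X,\Sigma')$. Gelfand dual compactification: for a combing $\Sigma'$ of $X$, $C_{\Sigma'}(X)$ is the $C^*$-algebra of continuous bounded $f\colon X\to\mathbb C$ such that $f\circ\Sigma'_n\to f$ uniformly and, for all $R>0$ and $\epsilon>0$, $\sup\{|f(y)-f(x)|:y\in\overline B(x,R)\}<\epsilon$ for all $x$ outside some compact set. $\overline X^{\Sigma'}$ is the space of non-zero multiplicative $\mathbb C$-linear functionals on $C_{\Sigma'}(X)$ with the weak-$*$ topology; $X$ embeds in it by $x\mapsto\delta_x$, evaluation at $x$. $G$ acts on $\overline X^{\Sigma'}$ by $(g_*\phi)(f)=\phi(f\circ g)$. *)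

theory Defs
  imports "HOL-Analysis.Analysis" "HOL-Algebra.Group_Action" "HOL-Algebra.Generated_Groups"
begin

subsection \<open>Geometric actions\<close>

definition orbit_topology ::
  "('g, 'm) monoid_scheme \<Rightarrow> ('g \<Rightarrow> 'a::topological_space \<Rightarrow> 'a) \<Rightarrow> 'a set topology" where
  "orbit_topology G \<phi> =
     topology (\<lambda>U. U \<subseteq> orbits G UNIV \<phi> \<and> open {x. orbit G \<phi> x \<in> U})"

lemma openin_orbit_topology:
  "openin (orbit_topology G \<phi>) U \<longleftrightarrow>
     U \<subseteq> orbits G UNIV \<phi> \<and> open {x. orbit G \<phi> x \<in> U}"
proof -
  have "open {x. orbit G \<phi> x \<in> S \<inter> T}"
    if "open {x. orbit G \<phi> x \<in> S}" "open {x. orbit G \<phi> x \<in> T}" for S T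
  proof -
    have "{x. orbit G \<phi> x \<in> S \<inter> T} = {x. orbit G \<phi> x \<in> S} \<inter> {x. orbit G \<phi> x \<in> T}"
      by blast
    with that show ?thesis by (simp only: open_Int)
  qed
  moreover have "open {x. orbit G \<phi> x \<in> \<Union>K}"
    if "\<forall>U\<in>K. open {x. orbit G \<phi> x \<in> U}" for K
  proof -
    have "{x. orbit G \<phi> x \<in> \<Union>K} = (\<Union>U\<in>K. {x. orbit G \<phi> x \<in> U})"
      by blast
    with that show ?thesis by (simp only: open_UN)
  qed
  ultimately have "istopology (\<lambda>U. U \<subseteq> orbits G UNIV \<phi> \<and> open {x. orbit G \<phi> x \<in> U})"
    unfolding istopology_def by (intro conjI allI impI) blast+
  then show ?thesis
    by (simp add: orbit_topology_def topology_inverse')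
qed

definition geometric_action ::
  "('g, 'm) monoid_scheme \<Rightarrow> ('g \<Rightarrow> 'a::metric_space \<Rightarrow> 'a) \<Rightarrow> bool" where
  "geometric_action G \<phi> \<longleftrightarrow>
     group_action G UNIV \<phi> \<and>
     (\<forall>g\<in>carrier G. \<forall>x y. dist (\<phi> g x) (\<phi> g y) = dist x y) \<and>
     (\<forall>K. compact K \<longrightarrow> finite {g \<in> carrier G. \<phi> g ` K \<inter> K \<noteq> {}}) \<and>
     compact_space (orbit_topology G \<phi>)"


subsection \<open>Bicombings\<close>

definition bicombing :: "('a::metric_space \<Rightarrow> 'a \<Rightarrow> real \<Rightarrow> 'a) \<Rightarrow> bool" where
  "bicombing \<sigma> \<longleftrightarrow>
     continuous_on (UNIV \<times> UNIV \<times> {0..1}) (\<lambda>(x, y, t). \<sigma> x y t) \<and>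
     (\<forall>x y. \<sigma> x y 0 = x \<and> \<sigma> x y 1 = y \<and>
        (\<forall>s\<in>{0..1}. \<forall>t\<in>{0..1}. dist (\<sigma> x y s) (\<sigma> x y t) = \<bar>s - t\<bar> * dist x y))"

definition consistent :: "('a::metric_space \<Rightarrow> 'a \<Rightarrow> real \<Rightarrow> 'a) \<Rightarrow> bool" where
  "consistent \<sigma> \<longleftrightarrow>
     (\<forall>x y s t. 0 \<le> s \<and> s < t \<and> t \<le> 1 \<longrightarrow>
        \<sigma> (\<sigma> x y s) (\<sigma> x y t) ` {0..1} = \<sigma> x y ` {s..t})"

definition conical :: "('a::metric_space \<Rightarrow> 'a \<Rightarrow> real \<Rightarrow> 'a) \<Rightarrow> bool" where
  "conical \<sigma> \<longleftrightarrow>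
     (\<forall>x y x' y'. \<forall>t\<in>{0..1}.
        dist (\<sigma> x y t) (\<sigma> x' y' t) \<le> (1 - t) * dist x x' + t * dist y y')"

definition equivariant_bicombing ::
  "('g, 'm) monoid_scheme \<Rightarrow> ('g \<Rightarrow> 'a::metric_space \<Rightarrow> 'a) \<Rightarrow> ('a \<Rightarrow> 'a \<Rightarrow> real \<Rightarrow> 'a) \<Rightarrow> bool" where
  "equivariant_bicombing G \<phi> \<sigma> \<longleftrightarrow>
     (\<forall>g\<in>carrier G. \<forall>x y. \<forall>t\<in>{0..1}. \<phi> g (\<sigma> x y t) = \<sigma> (\<phi> g x) (\<phi> g y) t)"


subsection \<open>The compactification by classes of rays\<close>

text \<open>Maps defined on \<open>[0,\<infinity>)\<close> are represented by functions that are \<^const>\<open>undefined\<close>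
  on the negative reals, so that a ray is determined by its values on \<open>[0,\<infinity>)\<close>.\<close>

definition sigma_rays :: "('a::metric_space \<Rightarrow> 'a \<Rightarrow> real \<Rightarrow> 'a) \<Rightarrow> (real \<Rightarrow> 'a) set" where
  "sigma_rays \<sigma> =
     {\<xi> \<in> extensional {0..}.
        (\<forall>s\<ge>0. \<forall>t\<ge>0. dist (\<xi> s) (\<xi> t) = \<bar>s - t\<bar>) \<and>
        (\<forall>t\<ge>0. \<sigma> (\<xi> 0) (\<xi> t) ` {0..1} = \<xi> ` {0..t})}"

definition asymptotic :: "('a::metric_space \<Rightarrow> 'a \<Rightarrow> real \<Rightarrow> 'a) \<Rightarrow> ((real \<Rightarrow> 'a) \<times> (real \<Rightarrow> 'a)) set" where
  "asymptotic \<sigma> =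
     {(\<xi>, \<zeta>). \<xi> \<in> sigma_rays \<sigma> \<and> \<zeta> \<in> sigma_rays \<sigma> \<and>
        bdd_above ((\<lambda>t. dist (\<xi> t) (\<zeta> t)) ` {0..})}"

definition sigma_boundary :: "('a::metric_space \<Rightarrow> 'a \<Rightarrow> real \<Rightarrow> 'a) \<Rightarrow> (real \<Rightarrow> 'a) set set" where
  "sigma_boundary \<sigma> = sigma_rays \<sigma> // asymptotic \<sigma>"

type_synonym 'a sigma_point = "'a + (real \<Rightarrow> 'a) set"

definition sigma_bar :: "('a::metric_space \<Rightarrow> 'a \<Rightarrow> real \<Rightarrow> 'a) \<Rightarrow> 'a sigma_point set" where
  "sigma_bar \<sigma> = range Inl \<union> Inr ` sigma_boundary \<sigma>"

fun rho :: "('a::metric_space \<Rightarrow> 'a \<Rightarrow> real \<Rightarrow> 'a) \<Rightarrow> 'a \<Rightarrow> 'a sigma_point \<Rightarrow> real \<Rightarrow> 'a" where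
  "rho \<sigma> p (Inl x) t = (if x = p then p else \<sigma> p x (min (t / dist p x) 1))"
| "rho \<sigma> p (Inr c) t = (THE \<xi>. \<xi> \<in> c \<and> \<xi> 0 = p) t"

definition sigma_nbhd ::
  "('a::metric_space \<Rightarrow> 'a \<Rightarrow> real \<Rightarrow> 'a) \<Rightarrow> 'a \<Rightarrow> 'a sigma_point \<Rightarrow> real \<Rightarrow> real \<Rightarrow> 'a sigma_point set" where
  "sigma_nbhd \<sigma> p z t \<epsilon> = {w \<in> sigma_bar \<sigma>. dist (rho \<sigma> p w t) (rho \<sigma> p z t) < \<epsilon>}"

definition sigma_topology ::
  "('a::metric_space \<Rightarrow> 'a \<Rightarrow> real \<Rightarrow> 'a) \<Rightarrow> 'a \<Rightarrow> 'a sigma_point topology" where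
  "sigma_topology \<sigma> p =
     topology_generated_by {sigma_nbhd \<sigma> p z t \<epsilon> | z t \<epsilon>. z \<in> sigma_bar \<sigma> \<and> 0 \<le> t \<and> 0 < \<epsilon>}"

fun sigma_act ::
  "('g \<Rightarrow> 'a::metric_space \<Rightarrow> 'a) \<Rightarrow> ('a \<Rightarrow> 'a \<Rightarrow> real \<Rightarrow> 'a) \<Rightarrow> 'g \<Rightarrow> 'a sigma_point \<Rightarrow> 'a sigma_point" where
  "sigma_act \<phi> \<sigma> g (Inl x) = Inl (\<phi> g x)"
| "sigma_act \<phi> \<sigma> g (Inr c) = Inr (\<Union>\<xi>\<in>c. asymptotic \<sigma> `` {restrict (\<lambda>t. \<phi> g (\<xi> t)) {0..}})"


subsection \<open>Combings\<close>

definition combing ::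
  "'b set \<Rightarrow> ('b \<Rightarrow> 'b \<Rightarrow> real) \<Rightarrow> 'b \<Rightarrow> ('b \<Rightarrow> nat \<Rightarrow> 'b) \<Rightarrow> bool" where
  "combing Y d b S \<longleftrightarrow>
     b \<in> Y \<and> (\<forall>y\<in>Y. \<forall>n. S y n \<in> Y) \<and>
     (\<forall>n. S b n = b) \<and> (\<forall>y\<in>Y. S y 0 = b) \<and>
     (\<forall>R\<ge>0. \<exists>N. \<forall>n\<ge>N. \<forall>y\<in>Y. d b y \<le> R \<longrightarrow> S y n = y) \<and>
     (\<forall>D>0. \<exists>C. \<forall>y\<in>Y. \<forall>y'\<in>Y. \<forall>n n'.
        d y y' \<le> D \<and> \<bar>real n - real n'\<bar> \<le> D \<longrightarrow> d (S y n) (S y' n') \<le> C)"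

definition combing_morphism ::
  "'b set \<Rightarrow> ('b \<Rightarrow> nat \<Rightarrow> 'b) \<Rightarrow> ('c \<Rightarrow> 'c \<Rightarrow> real) \<Rightarrow> ('c \<Rightarrow> nat \<Rightarrow> 'c) \<Rightarrow> ('b \<Rightarrow> 'c) \<Rightarrow> bool" where
  "combing_morphism Y1 S1 d2 S2 \<alpha> \<longleftrightarrow>
     (\<exists>C. \<forall>y\<in>Y1. \<forall>n. d2 (\<alpha> (S1 y n)) (S2 (\<alpha> y) n) \<le> C)"

definition word_length :: "('g, 'm) monoid_scheme \<Rightarrow> 'g set \<Rightarrow> 'g \<Rightarrow> nat" where
  "word_length G S g =
     (LEAST n. \<exists>ws. length ws = n \<and> set ws \<subseteq> S \<union> m_inv G ` S \<and>
        foldr (mult G) ws (one G) = g)"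

definition word_dist :: "('g, 'm) monoid_scheme \<Rightarrow> 'g set \<Rightarrow> 'g \<Rightarrow> 'g \<Rightarrow> real" where
  "word_dist G S g h = real (word_length G S (mult G (m_inv G g) h))"

text \<open>For a quasi-isometry \<open>\<alpha>\<close>, a map \<open>\<beta>\<close> with these properties is itself a quasi-isometry.\<close>

definition quasi_inverse ::
  "'b set \<Rightarrow> ('b \<Rightarrow> 'b \<Rightarrow> real) \<Rightarrow> 'c set \<Rightarrow> ('c \<Rightarrow> 'c \<Rightarrow> real) \<Rightarrow> ('b \<Rightarrow> 'c) \<Rightarrow> ('c \<Rightarrow> 'b) \<Rightarrow> bool" where
  "quasi_inverse Y1 d1 Y2 d2 \<alpha> \<beta> \<longleftrightarrow>
     \<beta> \<in> Y2 \<rightarrow> Y1 \<and>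
     (\<exists>C. (\<forall>y\<in>Y1. d1 (\<beta> (\<alpha> y)) y \<le> C) \<and> (\<forall>z\<in>Y2. d2 (\<alpha> (\<beta> z)) z \<le> C))"

definition bicombing_combing ::
  "('a::metric_space \<Rightarrow> 'a \<Rightarrow> real \<Rightarrow> 'a) \<Rightarrow> 'a \<Rightarrow> 'a \<Rightarrow> nat \<Rightarrow> 'a" where
  "bicombing_combing \<sigma> p x n = rho \<sigma> p (Inl x) (real n)"

definition transported_combing ::
  "('b \<Rightarrow> 'c) \<Rightarrow> ('c \<Rightarrow> 'b) \<Rightarrow> ('c \<Rightarrow> nat \<Rightarrow> 'c) \<Rightarrow> 'b \<Rightarrow> nat \<Rightarrow> 'b" where
  "transported_combing \<alpha> \<beta> S g n = \<beta> (S (\<alpha> g) n)"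


subsection \<open>The Gelfand dual compactification\<close>

definition combing_algebra :: "('a::metric_space \<Rightarrow> nat \<Rightarrow> 'a) \<Rightarrow> ('a \<Rightarrow> complex) set" where
  "combing_algebra S =
     {f. continuous_on UNIV f \<and> bounded (range f) \<and>
         uniform_limit UNIV (\<lambda>n x. f (S x n)) f sequentially \<and>
         (\<forall>R>0. \<forall>\<epsilon>>0. \<exists>K. compact K \<and>
            (\<forall>x. x \<notin> K \<longrightarrow> (SUP y\<in>cball x R. cmod (f y - f x)) < \<epsilon>))}"

text \<open>Functionals on the algebra \<open>C\<close> are represented by functions that are
  \<^const>\<open>undefined\<close> outside \<open>C\<close>; the weak-* topology is the topology of pointwise
  convergence on \<open>C\<close>.\<close>

definition characters :: "('a \<Rightarrow> complex) set \<Rightarrow> (('a \<Rightarrow> complex) \<Rightarrow> complex) set" where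
  "characters C =
     {\<psi> \<in> extensional C.
        (\<forall>f\<in>C. \<forall>h\<in>C. \<psi> (\<lambda>x. f x + h x) = \<psi> f + \<psi> h) \<and>
        (\<forall>c. \<forall>f\<in>C. \<psi> (\<lambda>x. c * f x) = c * \<psi> f) \<and>
        (\<forall>f\<in>C. \<forall>h\<in>C. \<psi> (\<lambda>x. f x * h x) = \<psi> f * \<psi> h) \<and>
        (\<exists>f\<in>C. \<psi> f \<noteq> 0)}"

definition gelfand_topology :: "('a \<Rightarrow> complex) set \<Rightarrow> (('a \<Rightarrow> complex) \<Rightarrow> complex) topology" where
  "gelfand_topology C = subtopology (product_topology (\<lambda>_. euclidean) C) (characters C)"

definition evaluation :: "('a \<Rightarrow> complex) set \<Rightarrow> 'a \<Rightarrow> ('a \<Rightarrow> complex) \<Rightarrow> complex" where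
  "evaluation C x = restrict (\<lambda>f. f x) C"

definition gelfand_act ::
  "('g \<Rightarrow> 'a \<Rightarrow> 'a) \<Rightarrow> ('a \<Rightarrow> complex) set \<Rightarrow> 'g \<Rightarrow>
     (('a \<Rightarrow> complex) \<Rightarrow> complex) \<Rightarrow> ('a \<Rightarrow> complex) \<Rightarrow> complex" where
  "gelfand_act \<phi> C g \<psi> = restrict (\<lambda>f. \<psi> (f \<circ> \<phi> g)) C"

end

theory Submission
  imports Defs
begin

text \<open>Write \<open>\<pi>\<^sub>s(x) = \<rho>\<^sub>q\<^sub>,\<^sub>x(s)\<close> for the projection to the ball of radius \<open>s\<close> around \<open>q\<close>. Consistency
  gives \<open>\<pi>\<^sub>s \<circ> \<pi>\<^sub>t = \<pi>\<^sub>s\<close> for \<open>s \<le> t\<close>, and conicality makes \<open>\<pi>\<^sub>s\<close> Lipschitz, with a constant of order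
  \<open>s / M\<close> outside the ball of radius \<open>M\<close>. Hence the ray compactification is the inverse limit of the
  closed balls around \<open>q\<close>. A function on \<open>X\<close> extends continuously to it if and only if it is a
  slowly oscillating (Higson) function with \<open>f \<circ> \<pi>\<^sub>n \<rightarrow> f\<close> uniformly. Since \<open>\<Sigma>'\<^sub>n\<close> stays within bounded
  distance of \<open>\<pi>\<^sub>n\<close>, these functions are exactly the algebra of \<open>\<Sigma>'\<close>, and Gelfand duality
  identifies its characters with the points of the ray compactification.\<close>

subsection \<open>Projections along a bicombing\<close>

declare rho.simps [simp del]

text \<open>Conicality compares two segments at equal parameters, whereas the topology and the
  combing compare them at equal radii. Passing from one to the other costs the difference of the
  lengths, and this is the origin of the factor 2 in the distance bounds for projections. The gain
  is the ratio s / M: it forces asymptotic rays from one point to coincide, makes the segments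
  towards a ray converge, and makes continuous functions on the compactification oscillate slowly.
  The given combing \<Sigma>' is controlled only up to a bounded error along one orbit, and it may
  have its own basepoint. It is compared with the bicombing only through functions: a bounded
  displacement far out is invisible in the limit to a slowly oscillating function, and on a bounded
  set both combings are eventually the identity. So the two algebras are equal, not merely
  isomorphic. The same mechanism gives equivariance: an element g carries the rays from q to rays
  from g q, which stay a bounded distance from the rays from q in the same classes.\<close>

locale bicombed_space =
  fixes \<sigma> :: "'a::metric_space \<Rightarrow> 'a \<Rightarrow> real \<Rightarrow> 'a"
  assumes proper: "\<And>(x::'a) r. compact (cball x r)"
    and bicombing: "bicombing \<sigma>"
    and consistent: "consistent \<sigma>"
    and conical: "conical \<sigma>"
begin

lemma sigma_0 [simp]: "\<sigma> x y 0 = x" and sigma_1 [simp]: "\<sigma> x y 1 = y"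
  using bicombing by (auto simp: bicombing_def)

lemma dist_sigma:
  "s \<in> {0..1} \<Longrightarrow> t \<in> {0..1} \<Longrightarrow> dist (\<sigma> x y s) (\<sigma> x y t) = \<bar>s - t\<bar> * dist x y"
  using bicombing by (auto simp: bicombing_def)

lemma dist_sigma_start: "t \<in> {0..1} \<Longrightarrow> dist x (\<sigma> x y t) = t * dist x y"
  using dist_sigma[of 0 t x y] by simp

lemma sigma_conical:
  "t \<in> {0..1} \<Longrightarrow> dist (\<sigma> x y t) (\<sigma> x' y' t) \<le> (1 - t) * dist x x' + t * dist y y'"
  using conical unfolding conical_def by blast

lemma sigma_param_unique:
  assumes "s \<in> {0..1}" "t \<in> {0..1}" "s * dist x y = t * dist x y"
  shows "\<sigma> x y s = \<sigma> x y t"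
proof -
  have "s = t \<or> dist x y = 0" using assms(3) by auto
  then show ?thesis using dist_sigma[OF assms(1,2), of x y] by auto
qed

text \<open>Consistency only equates images. The parameter is recovered from the distance to x,
  which determines a point on a segment issuing from x.\<close>

lemma sigma_initial_segment:
  assumes "t \<in> {0..1}" "u \<in> {0..1}"
  shows "\<sigma> x (\<sigma> x y t) u = \<sigma> x y (u * t)"
proof (cases "t = 0")
  case True
  have "\<sigma> x x u = x" using dist_sigma_start[OF assms(2), of x x] by simp
  then show ?thesis using True by simp
next
  case False
  then have "0 < t" "t \<le> 1" using assms(1) by auto
  then have "\<sigma> (\<sigma> x y 0) (\<sigma> x y t) ` {0..1} = \<sigma> x y ` {0..t}"
    using consistent unfolding consistent_def by blast
  then have "\<sigma> x (\<sigma> x y t) u \<in> \<sigma> x y ` {0..t}" using assms(2) by auto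
  then obtain v where v: "v \<in> {0..t}" "\<sigma> x (\<sigma> x y t) u = \<sigma> x y v" by blast
  have v1: "v \<in> {0..1}" using v \<open>t \<le> 1\<close> by auto
  have "u * (t * dist x y) = v * dist x y"
    using dist_sigma_start[OF assms(2), of x "\<sigma> x y t"] dist_sigma_start[OF assms(1), of x y]
      dist_sigma_start[OF v1, of x y] v(2) by auto
  moreover have "u * t \<in> {0..1}" using assms by (auto simp: mult_le_one)
  ultimately show ?thesis using v(2) sigma_param_unique[of "u * t" v x y] v1 by simp
qed

section \<open>Radial projections onto balls and their Lipschitz bounds\<close>

definition proj :: "'a \<Rightarrow> real \<Rightarrow> 'a \<Rightarrow> 'a" where
  "proj q s x = rho \<sigma> q (Inl x) s"

text \<open>The case x = q needs no separate treatment: division by zero gives parameter 0, and the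
  segment starts at q.\<close>

lemma proj_eq_sigma: "proj q s x = \<sigma> q x (min (s / dist q x) 1)"
  by (auto simp: proj_def rho.simps)

lemma proj_param:
  assumes "0 \<le> s"
  obtains u where "u \<in> {0..1}" "proj q s x = \<sigma> q x u" "u * dist q x = min s (dist q x)"
proof
  let ?u = "min (s / dist q x) 1"
  show "?u \<in> {0..1}" using assms by auto
  show "proj q s x = \<sigma> q x ?u" by (rule proj_eq_sigma)
  show "?u * dist q x = min s (dist q x)"
    using assms by (cases "q = x") (auto simp: min_def divide_simps)
qed

lemma proj_eqI:
  assumes "0 \<le> s" "u \<in> {0..1}" "u * dist q x = min s (dist q x)"
  shows "proj q s x = \<sigma> q x u"
proof -
  obtain v where "v \<in> {0..1}" "proj q s x = \<sigma> q x v" "v * dist q x = min s (dist q x)"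
    using proj_param[OF assms(1)] by blast
  then show ?thesis using sigma_param_unique[of v u q x] assms by simp
qed

lemma dist_proj:
  assumes "0 \<le> s" "0 \<le> t"
  shows "dist (proj q s x) (proj q t x) = \<bar>min s (dist q x) - min t (dist q x)\<bar>"
proof -
  obtain u where u: "u \<in> {0..1}" "proj q s x = \<sigma> q x u" "u * dist q x = min s (dist q x)"
    using proj_param[OF assms(1)] by blast
  obtain v where v: "v \<in> {0..1}" "proj q t x = \<sigma> q x v" "v * dist q x = min t (dist q x)"
    using proj_param[OF assms(2)] by blast
  have "\<bar>u - v\<bar> * dist q x = \<bar>u * dist q x - v * dist q x\<bar>"
    by (simp add: abs_mult flip: left_diff_distrib)
  then show ?thesis using u v dist_sigma[OF u(1) v(1)] by simp
qed

lemma proj_0 [simp]: "proj q 0 x = q"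
  by (simp add: proj_eq_sigma)

lemma proj_self: "dist q x \<le> s \<Longrightarrow> proj q s x = x"
  using proj_eqI[of s 1 q x] order_trans[OF zero_le_dist] by fastforce

lemma dist_proj_start: "0 \<le> s \<Longrightarrow> dist q (proj q s x) = min s (dist q x)"
  using dist_proj[of 0 s q x] by simp

lemma dist_proj_end: "0 \<le> s \<Longrightarrow> dist x (proj q s x) = dist q x - min s (dist q x)"
  using dist_proj[of "dist q x" s q x] proj_self[of q x "dist q x"] by simp

lemma proj_proj:
  assumes "0 \<le> s" "0 \<le> t"
  shows "proj q s (proj q t x) = proj q (min s t) x"
proof -
  obtain u where u: "u \<in> {0..1}" "proj q t x = \<sigma> q x u" "u * dist q x = min t (dist q x)"
    using proj_param[OF assms(2)] by blast
  obtain v where v: "v \<in> {0..1}" "proj q s (proj q t x) = \<sigma> q (proj q t x) v"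
    "v * dist q (proj q t x) = min s (dist q (proj q t x))"
    using proj_param[OF assms(1)] by blast
  have "proj q s (proj q t x) = \<sigma> q x (v * u)"
    using u v sigma_initial_segment by simp
  moreover have "v * u * dist q x = min (min s t) (dist q x)"
    using v(3) u(3) dist_proj_start[OF assms(2), of q x] by (simp add: mult.assoc min.assoc)
  moreover have "v * u \<in> {0..1}" using u v by (auto simp: mult_le_one)
  ultimately show ?thesis using proj_eqI[of "min s t" "v * u" q x] assms by simp
qed

text \<open>Let a \<le> b be the distances of the two points from q. Conicality at the common
  parameter s / a contributes (s / a) * \<open>dist x y\<close>. Sliding along the longer segment
  from parameter s / a to s / b contributes (s / a) * (b - a), which the triangle inequality bounds
  by the same amount.\<close>

lemma dist_proj_proj_le_ratio:
  assumes "0 \<le> s" "0 < M" "s \<le> M" "M \<le> dist q x" "M \<le> dist q y"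
  shows "dist (proj q s x) (proj q s y) \<le> 2 * (s / M) * dist x y"
  using assms
proof (induction "dist q x" "dist q y" arbitrary: x y rule: linorder_wlog)
  case (le x y)
  let ?a = "dist q x" and ?b = "dist q y"
  have a: "0 < ?a" "s \<le> ?a" "0 < ?b" "s \<le> ?b" using le by auto
  have u: "s / ?a \<in> {0..1}" "s / ?b \<in> {0..1}" using a le by auto
  have 1: "proj q s x = \<sigma> q x (s / ?a)" "proj q s y = \<sigma> q y (s / ?b)"
    using proj_eqI[of s "s / ?a" q x] proj_eqI[of s "s / ?b" q y] u a le by auto
  have 2: "dist (\<sigma> q x (s / ?a)) (\<sigma> q y (s / ?a)) \<le> s / ?a * dist x y"
    using sigma_conical[OF u(1), of q x q y] by simp
  have "dist (\<sigma> q y (s / ?a)) (\<sigma> q y (s / ?b)) = \<bar>s / ?a - s / ?b\<bar> * ?b"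
    using dist_sigma u by blast
  also have "\<dots> = \<bar>(s / ?a - s / ?b) * ?b\<bar>" by (simp add: abs_mult)
  also have "(s / ?a - s / ?b) * ?b = s / ?a * (?b - ?a)" using a by (simp add: field_simps)
  also have "\<bar>s / ?a * (?b - ?a)\<bar> = s / ?a * (?b - ?a)" using le by simp
  also have "\<dots> \<le> s / ?a * dist x y"
    using dist_triangle[of q y x] u by (intro mult_left_mono) auto
  finally have 3: "dist (\<sigma> q y (s / ?a)) (\<sigma> q y (s / ?b)) \<le> s / ?a * dist x y" .
  have 4: "s / ?a * dist x y \<le> s / M * dist x y"
    using le a by (intro mult_right_mono divide_left_mono) auto
  have "dist (proj q s x) (proj q s y) \<le> s / M * dist x y + s / M * dist x y"
    unfolding 1
    by (rule order_trans[OF dist_triangle add_mono[OF order_trans[OF 2 4] order_trans[OF 3 4]]])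
  then show ?case by (simp only: mult_2 distrib_right)
next
  case (sym y x)
  then show ?case by (simp add: dist_commute)
qed

text \<open>If both points are outside radius s, the ratio estimate applies with M = s. Otherwise
  the nearer point is fixed, and the farther one moves by at most the difference of their distances
  from q.\<close>

lemma dist_proj_proj_le:
  assumes "0 \<le> s"
  shows "dist (proj q s x) (proj q s y) \<le> 2 * dist x y"
  using assms
proof (induction "dist q x" "dist q y" arbitrary: x y rule: linorder_wlog)
  case (le x y)
  consider "s = 0" | "0 < s" "s \<le> dist q x" | "dist q x < s" using le by linarith
  then show ?case
  proof cases
    case 2
    then show ?thesis using dist_proj_proj_le_ratio[of s s q x y] le by simp
  next
    case 3
    have "dist x (proj q s y) \<le> dist x y + dist y (proj q s y)" by (rule dist_triangle)
    also have "\<dots> \<le> dist x y + (dist q y - dist q x)"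
      using dist_proj_end[OF le(2), of y q] 3 le by simp
    also have "\<dots> \<le> 2 * dist x y" using dist_triangle[of q y x] by simp
    finally show ?thesis using proj_self[of q x s] 3 by simp
  qed simp
next
  case (sym y x)
  then show ?case by (simp add: dist_commute)
qed

lemma continuous_on_proj [continuous_intros]:
  assumes "0 \<le> s" "continuous_on A f"
  shows "continuous_on A (\<lambda>x. proj q s (f x))"
proof -
  have "2-lipschitz_on UNIV (proj q s)"
    using dist_proj_proj_le[OF assms(1)] by (intro lipschitz_onI) auto
  then have "continuous_on UNIV (proj q s)" by (rule lipschitz_on_continuous_on)
  then show ?thesis using continuous_on_compose2[OF _ assms(2)] by blast
qed

lemma tendsto_proj:
  assumes "0 \<le> s" "(f \<longlongrightarrow> l) F"
  shows "((\<lambda>x. proj q s (f x)) \<longlongrightarrow> proj q s l) F"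
  using continuous_on_tendsto_compose[OF continuous_on_proj[OF assms(1) continuous_on_id] assms(2),
      of UNIV] by simp

text \<open>The two segments share the endpoint x, so conicality at a common parameter costs at most
  \<open>dist q o'\<close>; correcting the parameter to the right radius costs at most the
  difference of the lengths, again \<open>dist q o'\<close>. The bound is uniform in s and
  x.\<close>

lemma dist_proj_basepoint_le:
  assumes "0 \<le> s"
  shows "dist (proj q s x) (proj o' s x) \<le> 2 * dist q o'"
  using assms
proof (induction "dist q x" "dist o' x" arbitrary: q o' rule: linorder_wlog)
  case (le q o')
  let ?a = "dist q x" and ?b = "dist o' x"
  have ba: "?b - ?a \<le> dist q o'" using dist_triangle[of o' x q] by (simp add: dist_commute)
  consider "s = 0" | "0 < s" "s \<le> ?a" | "?a < s" using le by linarith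
  then show ?case
  proof cases
    case 2
    then have a: "0 < ?a" "s \<le> ?a" "0 < ?b" "s \<le> ?b" using le by auto
    have u: "s / ?a \<in> {0..1}" "s / ?b \<in> {0..1}" using a le by auto
    have 1: "proj q s x = \<sigma> q x (s / ?a)" "proj o' s x = \<sigma> o' x (s / ?b)"
      using proj_eqI[of s "s / ?a" q x] proj_eqI[of s "s / ?b" o' x] u a le by auto
    have "dist (\<sigma> q x (s / ?a)) (\<sigma> o' x (s / ?a)) \<le> (1 - s / ?a) * dist q o'"
      using sigma_conical[OF u(1), of q x o' x] by simp
    also have "\<dots> \<le> 1 * dist q o'" using u by (intro mult_right_mono) auto
    finally have 2: "dist (\<sigma> q x (s / ?a)) (\<sigma> o' x (s / ?a)) \<le> dist q o'" by simp
    have "dist (\<sigma> o' x (s / ?a)) (\<sigma> o' x (s / ?b)) = \<bar>s / ?a - s / ?b\<bar> * ?b"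
      using dist_sigma u by blast
    also have "\<dots> = \<bar>(s / ?a - s / ?b) * ?b\<bar>" by (simp add: abs_mult)
    also have "(s / ?a - s / ?b) * ?b = s / ?a * (?b - ?a)" using a by (simp add: field_simps)
    also have "\<bar>s / ?a * (?b - ?a)\<bar> = s / ?a * (?b - ?a)" using le by simp
    also have "\<dots> \<le> 1 * (?b - ?a)" using u le by (intro mult_right_mono) auto
    finally have "dist (\<sigma> o' x (s / ?a)) (\<sigma> o' x (s / ?b)) \<le> dist q o'" using ba by simp
    then show ?thesis
      using dist_triangle[of "proj q s x" "proj o' s x" "\<sigma> o' x (s / ?a)"] 1 2 by simp
  next
    case 3
    then show ?thesis
      using dist_proj_end[OF le(2), of x o'] proj_self[of q x s] ba zero_le_dist[of q o']
      by (simp add: min_def)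
  qed simp
next
  case (sym q o')
  then show ?case by (simp add: dist_commute)
qed


subsection \<open>Rays\<close>

text \<open>The image condition is traded for compatibility under projections, which survives
  pointwise limits and is the form in which a ray is a point of an inverse limit. Distances from
  \<xi> 0 suffice on the right: \<xi> s and \<xi> t are then projections of one point, and
  \<open>dist_proj\<close> gives their mutual distance.\<close>

lemma sigma_rays_iff:
  "\<xi> \<in> sigma_rays \<sigma> \<longleftrightarrow> \<xi> \<in> extensional {0..} \<and> (\<forall>t\<ge>0. dist (\<xi> 0) (\<xi> t) = t) \<and>
     (\<forall>s t. 0 \<le> s \<and> s \<le> t \<longrightarrow> \<xi> s = proj (\<xi> 0) s (\<xi> t))" (is "?L \<longleftrightarrow> ?R")
proof
  assume L: ?L
  then have d: "\<And>s t. 0 \<le> s \<Longrightarrow> 0 \<le> t \<Longrightarrow> dist (\<xi> s) (\<xi> t) = \<bar>s - t\<bar>"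
    and im: "\<And>t. 0 \<le> t \<Longrightarrow> \<sigma> (\<xi> 0) (\<xi> t) ` {0..1} = \<xi> ` {0..t}"
    by (auto simp: sigma_rays_def)
  have "\<xi> s = proj (\<xi> 0) s (\<xi> t)" if st: "0 \<le> s" "s \<le> t" for s t
  proof -
    have "\<xi> s \<in> \<sigma> (\<xi> 0) (\<xi> t) ` {0..1}" using im[of t] st by auto
    then obtain u where u: "u \<in> {0..1}" "\<xi> s = \<sigma> (\<xi> 0) (\<xi> t) u" by blast
    have "s = u * t" using dist_sigma_start[OF u(1), of "\<xi> 0" "\<xi> t"] u(2) d[of 0 s] d[of 0 t] st by simp
    then have "u * dist (\<xi> 0) (\<xi> t) = min s (dist (\<xi> 0) (\<xi> t))" using d[of 0 t] st by simp
    from proj_eqI[OF st(1) u(1) this] show ?thesis by (simp only: u(2))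
  qed
  moreover have "\<xi> \<in> extensional {0..}" using L by (simp add: sigma_rays_def)
  moreover have "\<forall>t\<ge>0. dist (\<xi> 0) (\<xi> t) = t" using d[of 0] by simp
  ultimately show ?R by blast
next
  assume R: ?R
  then have d0: "\<And>t. 0 \<le> t \<Longrightarrow> dist (\<xi> 0) (\<xi> t) = t"
    and pr: "\<And>s t. 0 \<le> s \<Longrightarrow> s \<le> t \<Longrightarrow> \<xi> s = proj (\<xi> 0) s (\<xi> t)" by blast+
  have d: "dist (\<xi> s) (\<xi> t) = \<bar>s - t\<bar>" if "0 \<le> s" "0 \<le> t" for s t
    using that
  proof (induction s t rule: linorder_wlog)
    case (le s t)
    have "dist (\<xi> s) (\<xi> t) = dist (proj (\<xi> 0) s (\<xi> t)) (proj (\<xi> 0) t (\<xi> t))"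
      by (intro arg_cong2[where f = dist] pr le order_refl)
    then show ?case using dist_proj[of s t "\<xi> 0" "\<xi> t"] d0[of t] le by simp
  qed (simp add: dist_commute abs_minus_commute)
  have im: "\<sigma> (\<xi> 0) (\<xi> t) ` {0..1} = \<xi> ` {0..t}" if t: "0 \<le> t" for t
  proof (intro equalityI subsetI)
    fix y assume "y \<in> \<sigma> (\<xi> 0) (\<xi> t) ` {0..1}"
    then obtain u where u: "u \<in> {0..1}" "y = \<sigma> (\<xi> 0) (\<xi> t) u" by blast
    have ut: "0 \<le> u * t" "u * t \<le> t" using u t by (auto simp: mult_left_le_one_le)
    then have "y = proj (\<xi> 0) (u * t) (\<xi> t)"
      using proj_eqI[of "u * t" u "\<xi> 0" "\<xi> t"] u d0[OF t] by simp
    also have "\<dots> = \<xi> (u * t)" by (rule pr[OF ut, symmetric])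
    finally show "y \<in> \<xi> ` {0..t}" using ut by auto
  next
    fix y assume "y \<in> \<xi> ` {0..t}"
    then obtain s where s: "0 \<le> s" "s \<le> t" "y = \<xi> s" by auto
    then have "y = proj (\<xi> 0) s (\<xi> t)" using pr by blast
    then show "y \<in> \<sigma> (\<xi> 0) (\<xi> t) ` {0..1}" using proj_param[OF s(1)] by blast
  qed
  show ?L using R d im unfolding sigma_rays_def by blast
qed

lemma sigma_ray_dist: "\<xi> \<in> sigma_rays \<sigma> \<Longrightarrow> 0 \<le> t \<Longrightarrow> dist (\<xi> 0) (\<xi> t) = t"
  and sigma_ray_proj: "\<xi> \<in> sigma_rays \<sigma> \<Longrightarrow> 0 \<le> s \<Longrightarrow> s \<le> t \<Longrightarrow> \<xi> s = proj (\<xi> 0) s (\<xi> t)"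
  unfolding sigma_rays_iff by blast+

lemma asymptotic_iff:
  "(\<xi>, \<zeta>) \<in> asymptotic \<sigma> \<longleftrightarrow>
     \<xi> \<in> sigma_rays \<sigma> \<and> \<zeta> \<in> sigma_rays \<sigma> \<and> (\<exists>B. \<forall>t\<ge>0. dist (\<xi> t) (\<zeta> t) \<le> B)"
  by (auto simp: asymptotic_def bdd_above_def)

lemma equiv_asymptotic: "equiv (sigma_rays \<sigma>) (asymptotic \<sigma>)"
proof (rule equivI)
  show "asymptotic \<sigma> \<subseteq> sigma_rays \<sigma> \<times> sigma_rays \<sigma>" by (auto simp: asymptotic_def)
  show "refl_on (sigma_rays \<sigma>) (asymptotic \<sigma>)"
    by (rule refl_onI) (auto simp: asymptotic_iff)
  show "sym (asymptotic \<sigma>)"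
    by (rule symI) (auto simp: asymptotic_iff dist_commute)
  show "trans (asymptotic \<sigma>)"
  proof (rule transI)
    fix \<xi> \<zeta> \<eta> assume "(\<xi>, \<zeta>) \<in> asymptotic \<sigma>" "(\<zeta>, \<eta>) \<in> asymptotic \<sigma>"
    then obtain B B' where B: "\<forall>t\<ge>0. dist (\<xi> t) (\<zeta> t) \<le> B" "\<forall>t\<ge>0. dist (\<zeta> t) (\<eta> t) \<le> B'"
      and r: "\<xi> \<in> sigma_rays \<sigma>" "\<eta> \<in> sigma_rays \<sigma>"
      by (auto simp: asymptotic_iff)
    have "dist (\<xi> t) (\<eta> t) \<le> B + B'" if "t \<ge> 0" for t
      using B that dist_triangle[of "\<xi> t" "\<eta> t" "\<zeta> t"] by (meson add_mono order_trans)
    then show "(\<xi>, \<eta>) \<in> asymptotic \<sigma>" using r by (auto simp: asymptotic_iff)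
  qed
qed

text \<open>Projecting from radius t to radius s shrinks a bounded distance B to at most 2 (s / t)
  B, and t is arbitrary.\<close>

lemma asymptotic_unique:
  assumes "(\<xi>, \<zeta>) \<in> asymptotic \<sigma>" "\<xi> 0 = \<zeta> 0"
  shows "\<xi> = \<zeta>"
proof -
  obtain B where B: "\<And>t. t \<ge> 0 \<Longrightarrow> dist (\<xi> t) (\<zeta> t) \<le> B"
    and r: "\<xi> \<in> sigma_rays \<sigma>" "\<zeta> \<in> sigma_rays \<sigma>"
    using assms by (auto simp: asymptotic_iff)
  have "\<xi> s = \<zeta> s" if s: "0 \<le> s" for s
  proof (rule ccontr)
    assume "\<xi> s \<noteq> \<zeta> s"
    define \<delta> where "\<delta> = dist (\<xi> s) (\<zeta> s)"
    have \<delta>: "\<delta> > 0" using \<open>\<xi> s \<noteq> \<zeta> s\<close> by (simp add: \<delta>_def)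
    have B0: "0 \<le> B" using B[of 0] zero_le_dist[of "\<xi> 0" "\<zeta> 0"] by linarith
    \<comment> \<open>Chosen so that \<delta> t exceeds 2 s B; the final 1 keeps t positive when s =
      0.\<close>
    define t where "t = s + 2 * s * B / \<delta> + 1"
    have "0 \<le> 2 * s * B / \<delta>" using s \<delta> B0 by simp
    then have t: "s \<le> t" "0 < t" using s by (auto simp: t_def)
    have "\<xi> s = proj (\<xi> 0) s (\<xi> t)" "\<zeta> s = proj (\<xi> 0) s (\<zeta> t)"
      using sigma_ray_proj[OF r(1) s t(1)] sigma_ray_proj[OF r(2) s t(1)] assms(2) by simp_all
    moreover have "dist (\<xi> 0) (\<xi> t) = t" "dist (\<xi> 0) (\<zeta> t) = t"
      using sigma_ray_dist[OF r(1), of t] sigma_ray_dist[OF r(2), of t] assms(2) t by simp_all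
    ultimately have "\<delta> \<le> 2 * (s / t) * dist (\<xi> t) (\<zeta> t)"
      using dist_proj_proj_le_ratio[of s t "\<xi> 0" "\<xi> t" "\<zeta> t"] s t by (simp add: \<delta>_def)
    also have "\<dots> \<le> 2 * (s / t) * B" using B s t by (intro mult_left_mono) auto
    finally have "\<delta> * t \<le> 2 * s * B" using t by (simp add: field_simps)
    moreover have "\<delta> * t = \<delta> * s + 2 * s * B + \<delta>" using \<delta> by (simp add: t_def field_simps)
    moreover have "0 \<le> \<delta> * s" using \<delta> s by simp
    ultimately show False using \<delta> by linarith
  qed
  then show ?thesis
    using r by (intro extensionalityI[of _ "{0..}"]) (auto simp: sigma_rays_def)
qed

text \<open>The ray from \<open>q\<close> is the limit of the segments from \<open>q\<close> to \<open>\<xi>(n)\<close>: for \<open>n \<le> m\<close> the points \<open>\<xi>(n)\<close> and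
  \<open>proj q n (\<xi>(m))\<close> are at distance at most \<open>2 D\<close>, which projecting to radius \<open>s\<close> shrinks by a factor
  of order \<open>s / n\<close>.\<close>

lemma asymptotic_ray_exists:
  assumes \<xi>: "\<xi> \<in> sigma_rays \<sigma>"
  obtains \<zeta> where "(\<xi>, \<zeta>) \<in> asymptotic \<sigma>" "\<zeta> 0 = q"
proof -
  define o' where "o' = \<xi> 0"
  define D where "D = dist q o'"
  have D0: "0 \<le> D" by (simp add: D_def)
  have d: "dist o' (\<xi> t) = t" if "0 \<le> t" for t using sigma_ray_dist[OF \<xi> that] by (simp add: o'_def)
  have pr: "\<xi> s = proj o' s (\<xi> t)" if "0 \<le> s" "s \<le> t" for s t
    using sigma_ray_proj[OF \<xi> that] by (simp add: o'_def)
  have far: "t - D \<le> dist q (\<xi> t)" if "0 \<le> t" for t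
    using d[OF that] dist_triangle[of o' "\<xi> t" q] by (simp add: D_def dist_commute)
  have close: "dist (proj q s (\<xi> t)) (\<xi> s) \<le> 2 * D" if "0 \<le> s" "s \<le> t" for s t
    using dist_proj_basepoint_le[OF that(1), of q "\<xi> t" o'] pr[OF that] by (simp add: D_def)
  have est: "dist (proj q s (\<xi> n)) (proj q s (\<xi> m)) \<le> 4 * D * s / (n - D)"
    if s: "0 \<le> s" "s \<le> n - D" "0 < n - D" "n \<le> m" for s n m
  proof -
    \<comment> \<open>The distance from \<xi> n to \<xi> m grows with m, so \<xi> m is replaced by
      \<open>?z\<close>, which has the same projection to radius s. Both \<xi> n and
      \<open>?z\<close> lie outside radius n - D, which plays the role of M in the ratio
      estimate.\<close>
    let ?z = "proj q n (\<xi> m)"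
    have n: "0 \<le> n" "0 \<le> m" "s \<le> n" using s D0 by auto
    have "proj q s ?z = proj q s (\<xi> m)" using proj_proj[of s n q "\<xi> m"] n s by simp
    moreover have "n - D \<le> dist q ?z"
      using dist_proj_start[OF n(1), of q "\<xi> m"] far[OF n(2)] s D0 by simp
    ultimately have "dist (proj q s (\<xi> n)) (proj q s (\<xi> m)) \<le> 2 * (s / (n - D)) * dist (\<xi> n) ?z"
      using dist_proj_proj_le_ratio[of s "n - D" q "\<xi> n" ?z] far[OF n(1)] s by simp
    also have "\<dots> \<le> 2 * (s / (n - D)) * (2 * D)"
      using close[OF n(1), of m] s by (intro mult_left_mono) (auto simp: dist_commute)
    finally show ?thesis by (simp add: mult_ac)
  qed
  have "\<exists>l. (\<lambda>n. proj q s (\<xi> (real n))) \<longlonglongrightarrow> l" if s: "0 \<le> s" for s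
  proof -
    have "Cauchy (\<lambda>n. proj q s (\<xi> (real n)))"
    proof (rule metric_CauchyI)
      fix e :: real assume e: "0 < e"
      obtain N :: nat where N: "s + D + 4 * D * s / e + 1 < real N" using reals_Archimedean2 by blast
      have *: "dist (proj q s (\<xi> (real n))) (proj q s (\<xi> (real m))) < e" if nm: "N \<le> n" "n \<le> m" for n m
      proof -
        have n: "s + D + 4 * D * s / e + 1 < real n" using N nm by linarith
        have nn: "0 \<le> 4 * D * s / e" using D0 s e by simp
        have "4 * D * s / e < real n - D" using n s by linarith
        then have "4 * D * s / (real n - D) < e" using e n s D0 nn
          by (smt (verit) divide_less_eq mult.commute)
        then show ?thesis using est[of s "real n" "real m"] s n nm nn by linarith
      qed
      show "\<exists>M. \<forall>m\<ge>M. \<forall>n\<ge>M. dist (proj q s (\<xi> (real m))) (proj q s (\<xi> (real n))) < e"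
        using * by (metis dist_commute nle_le)
    qed
    moreover have "\<And>n. proj q s (\<xi> (real n)) \<in> cball q s" using dist_proj_start[OF s] by simp
    ultimately show ?thesis
      using compact_imp_complete[OF proper[of q s]] completeE[of "cball q s"] by metis
  qed
  then obtain \<eta> where \<eta>: "\<And>s. 0 \<le> s \<Longrightarrow> (\<lambda>n. proj q s (\<xi> (real n))) \<longlonglongrightarrow> \<eta> s" by metis
  define \<zeta> where "\<zeta> = restrict \<eta> {0..}"
  have \<zeta>: "(\<lambda>n. proj q s (\<xi> (real n))) \<longlonglongrightarrow> \<zeta> s" if "0 \<le> s" for s
    using \<eta>[OF that] that by (simp add: \<zeta>_def)
  have \<zeta>0: "\<zeta> 0 = q" using LIMSEQ_unique[OF \<zeta>[of 0]] tendsto_const[of q] by fastforce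
  have "\<zeta> s = proj q s (\<zeta> t)" if "0 \<le> s" "s \<le> t" for s t
  proof -
    have t: "0 \<le> t" using that by simp
    have "(\<lambda>n. proj q s (proj q t (\<xi> (real n)))) \<longlonglongrightarrow> proj q s (\<zeta> t)"
      by (intro tendsto_proj \<zeta> that t)
    then have "(\<lambda>n. proj q s (\<xi> (real n))) \<longlonglongrightarrow> proj q s (\<zeta> t)"
      using proj_proj[OF that(1) t] that by (simp add: min_def)
    then show ?thesis using LIMSEQ_unique \<zeta>[OF that(1)] by blast
  qed
  moreover have "dist q (\<zeta> t) = t" if t: "0 \<le> t" for t
  proof -
    \<comment> \<open>By \<open>far\<close>, \<xi> n is at distance at least t from q once n \<ge> t
      + D, so its projection lies exactly on the sphere of radius t and the limit does not fall
      short of it.\<close>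
    have "\<forall>\<^sub>F n in sequentially. t + D \<le> real n"
      using eventually_ge_at_top[of "nat \<lceil>t + D\<rceil>"] by eventually_elim linarith
    then have "\<forall>\<^sub>F n in sequentially. dist q (proj q t (\<xi> (real n))) = t"
    proof eventually_elim
      case (elim n)
      then show ?case using dist_proj_start[OF t, of q "\<xi> (real n)"] far[of "real n"] by simp
    qed
    then have "(\<lambda>n. dist q (proj q t (\<xi> (real n)))) \<longlonglongrightarrow> t" by (rule tendsto_eventually)
    moreover have "(\<lambda>n. dist q (proj q t (\<xi> (real n)))) \<longlonglongrightarrow> dist q (\<zeta> t)"
      by (intro tendsto_intros \<zeta> t)
    ultimately show ?thesis using LIMSEQ_unique by blast
  qed
  moreover have "\<zeta> \<in> extensional {0..}" by (simp add: \<zeta>_def)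
  ultimately have ray: "\<zeta> \<in> sigma_rays \<sigma>" unfolding sigma_rays_iff \<zeta>0 by blast
  have "dist (\<xi> s) (\<zeta> s) \<le> 2 * D" if s: "0 \<le> s" for s
  proof -
    have "(\<lambda>n. dist (\<xi> s) (proj q s (\<xi> (real n)))) \<longlonglongrightarrow> dist (\<xi> s) (\<zeta> s)"
      by (intro tendsto_intros \<zeta> s)
    moreover have "\<forall>\<^sub>F n in sequentially. dist (\<xi> s) (proj q s (\<xi> (real n))) \<le> 2 * D"
      using eventually_ge_at_top[of "nat \<lceil>s\<rceil>"]
    proof eventually_elim
      case (elim n)
      then have "s \<le> real n" by linarith
      then show ?case using close[OF s] by (simp add: dist_commute)
    qed
    ultimately show ?thesis by (rule tendsto_upperbound) simp
  qed
  then have "(\<xi>, \<zeta>) \<in> asymptotic \<sigma>" using ray \<xi> by (auto simp: asymptotic_iff)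
  then show ?thesis using that \<zeta>0 by blast
qed

text \<open>Justifies the definite description in \<open>rho\<close>: asymptotic rays from one point
  coincide, and every class has a ray from q.\<close>

lemma rho_boundary:
  assumes "c \<in> sigma_boundary \<sigma>"
  shows "rho \<sigma> q (Inr c) \<in> c" "rho \<sigma> q (Inr c) 0 = q" "rho \<sigma> q (Inr c) \<in> sigma_rays \<sigma>"
proof -
  obtain \<xi> where \<xi>: "\<xi> \<in> sigma_rays \<sigma>" "c = asymptotic \<sigma> `` {\<xi>}"
    using assms by (auto simp: sigma_boundary_def elim: quotientE)
  obtain \<zeta> where \<zeta>: "(\<xi>, \<zeta>) \<in> asymptotic \<sigma>" "\<zeta> 0 = q" using asymptotic_ray_exists[OF \<xi>(1)] .
  have "\<exists>!\<eta>. \<eta> \<in> c \<and> \<eta> 0 = q"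
  proof (rule ex1I)
    show "\<zeta> \<in> c \<and> \<zeta> 0 = q" using \<xi> \<zeta> by auto
    fix \<eta> assume \<eta>: "\<eta> \<in> c \<and> \<eta> 0 = q"
    then have "(\<xi>, \<eta>) \<in> asymptotic \<sigma>" using \<xi> by auto
    then have "(\<zeta>, \<eta>) \<in> asymptotic \<sigma>"
      using \<zeta>(1) equiv_asymptotic unfolding equiv_def by (meson symD transD)
    then show "\<eta> = \<zeta>" using asymptotic_unique[of \<zeta> \<eta>] \<zeta> \<eta> by simp
  qed
  moreover have "rho \<sigma> q (Inr c) = (THE \<eta>. \<eta> \<in> c \<and> \<eta> 0 = q)" by (simp add: fun_eq_iff rho.simps)
  ultimately have "rho \<sigma> q (Inr c) \<in> c \<and> rho \<sigma> q (Inr c) 0 = q"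
    using theI'[of "\<lambda>\<eta>. \<eta> \<in> c \<and> \<eta> 0 = q"] by simp
  then show "rho \<sigma> q (Inr c) \<in> c" "rho \<sigma> q (Inr c) 0 = q" by auto
  then show "rho \<sigma> q (Inr c) \<in> sigma_rays \<sigma>"
    using \<xi> by (auto simp: asymptotic_iff)
qed

text \<open>This single identity lets interior and boundary points be treated alike from here
  on.\<close>

lemma rho_eq_proj:
  assumes "z \<in> sigma_bar \<sigma>" "0 \<le> s" "s \<le> t"
  shows "rho \<sigma> q z s = proj q s (rho \<sigma> q z t)"
proof (cases z)
  case (Inl x)
  then show ?thesis using proj_proj[of s t q x] assms by (simp add: proj_def[symmetric])
next
  case (Inr c)
  then have "c \<in> sigma_boundary \<sigma>" using assms by (auto simp: sigma_bar_def)
  from sigma_ray_proj[OF rho_boundary(3)[OF this, of q] assms(2,3)] rho_boundary(2)[OF this, of q]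
  show ?thesis using Inr by simp
qed

lemma dist_rho_boundary:
  assumes "c \<in> sigma_boundary \<sigma>" "0 \<le> t"
  shows "dist q (rho \<sigma> q (Inr c) t) = t"
  using sigma_ray_dist[OF rho_boundary(3)[OF assms(1), of q] assms(2)]
    rho_boundary(2)[OF assms(1), of q] by simp

lemma dist_rho_le:
  assumes "z \<in> sigma_bar \<sigma>" "0 \<le> t"
  shows "dist q (rho \<sigma> q z t) \<le> t"
proof (cases z)
  case (Inl x)
  then show ?thesis using dist_proj_start[of t q x] assms by (simp add: proj_def[symmetric])
next
  case (Inr c)
  then show ?thesis using assms dist_rho_boundary[of c t q] by (auto simp: sigma_bar_def)
qed

section \<open>Points of the compactification and compatible families of projections\<close>

lemma rho_Inl_eq_self:
  "dist q x \<le> t \<Longrightarrow> rho \<sigma> q (Inl x) t = x"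
  using proj_self[of q x t] by (simp add: proj_def[symmetric])

text \<open>Just beyond radius \<open>dist q x\<close> the trace of an interior point x has stopped,
  while a ray is still at full distance from q; this separates X from the boundary. Two classes with
  equal traces share a ray and hence coincide.\<close>

lemma rho_injective:
  assumes "z \<in> sigma_bar \<sigma>" "w \<in> sigma_bar \<sigma>" "\<And>t. 0 \<le> t \<Longrightarrow> rho \<sigma> q z t = rho \<sigma> q w t"
  shows "z = w"
proof -
  have mixed: False if c: "c \<in> sigma_boundary \<sigma>"
    and eq: "\<And>t. 0 \<le> t \<Longrightarrow> rho \<sigma> q (Inl x) t = rho \<sigma> q (Inr c) t" for x c
  proof -
    have "dist q x = dist q x + 1"
      using eq[of "dist q x + 1"] dist_rho_boundary[OF c, of "dist q x + 1" q]
        rho_Inl_eq_self[of q x "dist q x + 1"] by simp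
    then show False by simp
  qed
  consider x y where "z = Inl x" "w = Inl y" | x c where "z = Inl x" "w = Inr c"
    | x c where "z = Inr c" "w = Inl x" | c c' where "z = Inr c" "w = Inr c'"
    by (metis sum.exhaust)
  then show ?thesis
  proof cases
    case 1
    let ?t = "max (dist q x) (dist q y)"
    show ?thesis using assms(3)[of ?t] rho_Inl_eq_self[of q x ?t] rho_Inl_eq_self[of q y ?t]
      1 by (simp add: le_max_iff_disj)
  next
    case 2
    then show ?thesis using mixed[of c x] assms by (auto simp: sigma_bar_def)
  next
    case 3
    then show ?thesis using mixed[of c x] assms by (auto simp: sigma_bar_def)
  next
    case 4
    then have c: "c \<in> sigma_boundary \<sigma>" "c' \<in> sigma_boundary \<sigma>"
      using assms by (auto simp: sigma_bar_def)
    have "rho \<sigma> q z = rho \<sigma> q w"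
      using rho_boundary(3)[OF c(1), of q] rho_boundary(3)[OF c(2), of q] 4 assms(3)
      by (intro extensionalityI[of _ "{0..}"]) (auto simp: sigma_rays_def)
    then have "rho \<sigma> q (Inr c) \<in> c \<inter> c'" using rho_boundary(1)[OF c(1), of q] rho_boundary(1)[OF c(2), of q] 4
      by (simp)
    then show ?thesis
      using quotient_disj[OF equiv_asymptotic] c 4 unfolding sigma_boundary_def by blast
  qed
qed

text \<open>A dichotomy: either r t has distance t from q for all t, and r is a ray, or r falls
  short of some radius T. In the latter case projecting to radius T does nothing to later values, so
  r is constant beyond T and is the trace of the interior point r T.\<close>

lemma rho_surjective:
  assumes "\<And>t. 0 \<le> t \<Longrightarrow> dist q (r t) \<le> t" "\<And>s t. 0 \<le> s \<Longrightarrow> s \<le> t \<Longrightarrow> r s = proj q s (r t)"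
  shows "\<exists>z\<in>sigma_bar \<sigma>. \<forall>t\<ge>0. rho \<sigma> q z t = r t"
proof (cases "\<forall>t\<ge>0. dist q (r t) = t")
  case True
  define \<xi> where "\<xi> = restrict r {0..}"
  have "dist q (r 0) = 0" using True[rule_format, of 0] by simp
  then have r0: "r 0 = q" by simp
  have \<xi>: "\<xi> \<in> sigma_rays \<sigma>"
    unfolding sigma_rays_iff
  proof (intro conjI allI impI)
    fix s t :: real assume "0 \<le> s \<and> s \<le> t"
    then show "\<xi> s = proj (\<xi> 0) s (\<xi> t)" using assms(2)[of s t] r0 by (simp add: \<xi>_def)
  qed (use True r0 in \<open>auto simp: \<xi>_def\<close>)
  define c where "c = asymptotic \<sigma> `` {\<xi>}"
  have c: "c \<in> sigma_boundary \<sigma>" using \<xi> by (auto simp: c_def sigma_boundary_def intro: quotientI)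
  have "(\<xi>, rho \<sigma> q (Inr c)) \<in> asymptotic \<sigma>" using rho_boundary(1)[OF c] unfolding c_def by blast
  then have \<xi>_eq: "\<xi> = rho \<sigma> q (Inr c)"
    using asymptotic_unique rho_boundary(2)[OF c, of q] r0 by (simp add: \<xi>_def)
  then have "\<forall>t\<ge>0. rho \<sigma> q (Inr c) t = r t" by (simp add: \<xi>_def flip: \<xi>_eq)
  then show ?thesis using c by (auto simp: sigma_bar_def)
next
  case False
  then obtain T where T: "0 \<le> T" "dist q (r T) < T" using assms(1) by force
  have big: "r t = r T" if "T \<le> t" for t
  proof -
    have 1: "r T = proj q T (r t)" using assms(2) T that by blast
    then have "dist q (r t) < T"
      using dist_proj_start[OF T(1), of q "r t"] T by (simp add: min_def split: if_splits)
    then show ?thesis using 1 proj_self[of q "r t" T] by simp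
  qed
  have "rho \<sigma> q (Inl (r T)) t = r t" if t: "0 \<le> t" for t
  proof -
    have "r t = proj q t (r (max t T))" by (rule assms(2)[OF t]) simp
    also have "r (max t T) = r T" by (rule big) simp
    finally show ?thesis by (simp add: proj_def)
  qed
  then show ?thesis by (auto simp: sigma_bar_def)
qed

text \<open>Closeness at a large radius controls closeness at all smaller ones, so finitely many
  radii can be replaced by their maximum.\<close>

lemma dist_rho_mono:
  assumes "z \<in> sigma_bar \<sigma>" "w \<in> sigma_bar \<sigma>" "0 \<le> s" "s \<le> t"
  shows "dist (rho \<sigma> q z s) (rho \<sigma> q w s) \<le> 2 * dist (rho \<sigma> q z t) (rho \<sigma> q w t)"
  using dist_proj_proj_le[OF assms(3), of q "rho \<sigma> q z t" "rho \<sigma> q w t"]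
    rho_eq_proj[OF assms(1,3,4)] rho_eq_proj[OF assms(2,3,4)] by simp


subsection \<open>Topology of the ray compactification\<close>

lemma sigma_bar_Inl [simp]: "Inl x \<in> sigma_bar \<sigma>"
  by (simp add: sigma_bar_def)

lemma openin_sigma_nbhd:
  assumes "z \<in> sigma_bar \<sigma>" "0 \<le> t" "0 < \<epsilon>"
  shows "openin (sigma_topology \<sigma> q) (sigma_nbhd \<sigma> q z t \<epsilon>)"
  unfolding sigma_topology_def by (rule topology_generated_by_Basis) (use assms in blast)

lemma mem_sigma_nbhd [simp]: "z \<in> sigma_bar \<sigma> \<Longrightarrow> 0 < \<epsilon> \<Longrightarrow> z \<in> sigma_nbhd \<sigma> q z t \<epsilon>"
  by (simp add: sigma_nbhd_def)

lemma topspace_sigma_topology [simp]: "topspace (sigma_topology \<sigma> q) = sigma_bar \<sigma>"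
proof
  show "topspace (sigma_topology \<sigma> q) \<subseteq> sigma_bar \<sigma>"
    by (auto simp: sigma_topology_def sigma_nbhd_def)
  show "sigma_bar \<sigma> \<subseteq> topspace (sigma_topology \<sigma> q)"
    using openin_subset[OF openin_sigma_nbhd[of _ 0 1 q]] mem_sigma_nbhd[of _ 1 q 0] by fastforce
qed

text \<open>The topology is generated from the sets \<open>sigma_nbhd\<close> as a subbase. That
  they form a base of neighbourhoods, with the given point as centre, comes from comparing two radii
  by \<open>dist_rho_mono\<close>.\<close>

lemma sigma_topology_nbhd_base:
  assumes "openin (sigma_topology \<sigma> q) U" "z \<in> U"
  shows "\<exists>t\<ge>0. \<exists>\<epsilon>>0. sigma_nbhd \<sigma> q z t \<epsilon> \<subseteq> U"
proof -
  let ?B = "{sigma_nbhd \<sigma> q z t \<epsilon> | z t \<epsilon>. z \<in> sigma_bar \<sigma> \<and> 0 \<le> t \<and> 0 < \<epsilon>}"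
  have "generate_topology_on ?B U"
    using assms(1) unfolding sigma_topology_def by (rule openin_topology_generated_by)
  then show ?thesis using assms(2)
  proof (induction arbitrary: z)
    case Empty
    then show ?case by simp
  next
    case (Int a b)
    obtain t \<epsilon> where 1: "0 \<le> t" "0 < \<epsilon>" "sigma_nbhd \<sigma> q z t \<epsilon> \<subseteq> a" using Int by blast
    obtain t' \<epsilon>' where 2: "0 \<le> t'" "0 < \<epsilon>'" "sigma_nbhd \<sigma> q z t' \<epsilon>' \<subseteq> b" using Int by blast
    have "generate_topology_on ?B a" by fact
    then have "openin (sigma_topology \<sigma> q) a"
      by (simp add: sigma_topology_def openin_topology_generated_by_iff)
    then have z: "z \<in> sigma_bar \<sigma>" using openin_subset Int.prems by fastforce
    \<comment> \<open>Halving absorbs the factor 2 lost in passing to a smaller radius.\<close>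
    let ?t = "max t t'" and ?e = "min \<epsilon> \<epsilon>' / 2"
    have "sigma_nbhd \<sigma> q z ?t ?e \<subseteq> a \<inter> b"
    proof
      fix w assume "w \<in> sigma_nbhd \<sigma> q z ?t ?e"
      then have w: "w \<in> sigma_bar \<sigma>" "dist (rho \<sigma> q w ?t) (rho \<sigma> q z ?t) < ?e"
        by (auto simp: sigma_nbhd_def)
      have "dist (rho \<sigma> q w t) (rho \<sigma> q z t) < \<epsilon>"
        using dist_rho_mono[OF w(1) z 1(1), of ?t q] w(2) by linarith
      moreover have "dist (rho \<sigma> q w t') (rho \<sigma> q z t') < \<epsilon>'"
        using dist_rho_mono[OF w(1) z 2(1), of ?t q] w(2) by linarith
      ultimately show "w \<in> a \<inter> b" using 1 2 w by (auto simp: sigma_nbhd_def)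
    qed
    moreover have "0 \<le> ?t" "0 < ?e" using 1 2 by auto
    ultimately show ?case by blast
  next
    case (UN K)
    then show ?case by (meson Sup_upper UnionE order_trans)
  next
    case (Basis s)
    then obtain y t \<epsilon> where s: "s = sigma_nbhd \<sigma> q y t \<epsilon>" "0 \<le> t" by blast
    let ?e = "\<epsilon> - dist (rho \<sigma> q z t) (rho \<sigma> q y t)"
    have "0 < ?e" using Basis s by (auto simp: sigma_nbhd_def)
    moreover have "sigma_nbhd \<sigma> q z t ?e \<subseteq> s"
    proof
      fix w assume w: "w \<in> sigma_nbhd \<sigma> q z t ?e"
      then have "dist (rho \<sigma> q w t) (rho \<sigma> q y t) < \<epsilon>"
        using dist_triangle[of "rho \<sigma> q w t" "rho \<sigma> q y t" "rho \<sigma> q z t"]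
        by (simp add: sigma_nbhd_def)
      then show "w \<in> s" using w s by (simp add: sigma_nbhd_def)
    qed
    ultimately show ?case using s by blast
  qed
qed

text \<open>The map \<open>z \<mapsto> (\<rho>\<^sub>q\<^sub>,\<^sub>z(t))\<^sub>t\<close> identifies the compactification with the inverse limit of the
  closed balls around \<open>q\<close> under the projections \<open>proj q s\<close>, a closed subset of a product of
  compact sets.\<close>

lemma compact_space_sigma_topology: "compact_space (sigma_topology \<sigma> q)"
proof -
  define R where "R = {r. \<forall>s t. 0 \<le> s \<and> s \<le> t \<longrightarrow> r s = proj q s (r t)}"
  \<comment> \<open>At negative t, which R leaves free, the ball of radius 0 pins the coordinate to
    q.\<close>
  define P where "P = PiE UNIV (\<lambda>t. cball q (max t 0))"
  have "compactin (product_topology (\<lambda>_::real. euclidean) UNIV) P"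
    unfolding P_def by (subst compactin_PiE) (use proper in auto)
  then have "compact P" by (simp add: euclidean_product_topology)
  moreover have "closed R"
  proof -
    have "closed {r :: real \<Rightarrow> 'a. r s = proj q s (r t)}" if "0 \<le> s" for s t
      using that by (intro closed_Collect_eq continuous_on_proj continuous_on_product_coordinates)
    then have "closed (\<Inter>(s, t)\<in>{(s, t). 0 \<le> s \<and> s \<le> t}. {r. r s = proj q s (r t)})"
      by (intro closed_INT) auto
    moreover have "(\<Inter>(s, t)\<in>{(s, t). 0 \<le> s \<and> s \<le> t}. {r. r s = proj q s (r t)}) = R"
      unfolding R_def by blast
    ultimately show ?thesis by simp
  qed
  ultimately have PR: "compact (P \<inter> R)" by (rule compact_Int_closed)
  have ex: "\<exists>z\<in>sigma_bar \<sigma>. \<forall>t\<ge>0. rho \<sigma> q z t = r t" if "r \<in> P \<inter> R" for r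
  proof (rule rho_surjective)
    fix t :: real assume "0 \<le> t"
    have "r t \<in> cball q (max t 0)" using that by (auto simp: P_def)
    with \<open>0 \<le> t\<close> show "dist q (r t) \<le> t" by simp
  next
    show "r s = proj q s (r t)" if "0 \<le> s" "s \<le> t" for s t
      using \<open>r \<in> P \<inter> R\<close> that unfolding R_def by blast
  qed
  \<comment> \<open>Compactness is pushed forward along J, the inverse of the trace map: a subbasic
    set constrains one coordinate only, so its preimage is visibly open.\<close>
  then obtain J where J: "\<And>r. r \<in> P \<inter> R \<Longrightarrow> J r \<in> sigma_bar \<sigma>"
    "\<And>r t. r \<in> P \<inter> R \<Longrightarrow> 0 \<le> t \<Longrightarrow> rho \<sigma> q (J r) t = r t" by metis
  have "continuous_map (top_of_set (P \<inter> R)) (sigma_topology \<sigma> q) J"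
    unfolding sigma_topology_def
  proof (rule continuous_on_generated_topo)
    fix U assume "U \<in> {sigma_nbhd \<sigma> q z t \<epsilon> |z t \<epsilon>. z \<in> sigma_bar \<sigma> \<and> 0 \<le> t \<and> 0 < \<epsilon>}"
    then obtain z t \<epsilon> where U: "U = sigma_nbhd \<sigma> q z t \<epsilon>" "0 \<le> t" by blast
    have "J -` U \<inter> topspace (top_of_set (P \<inter> R)) = (P \<inter> R) \<inter> (\<lambda>r. r t) -` ball (rho \<sigma> q z t) \<epsilon>"
      using J U by (auto simp: sigma_nbhd_def dist_commute)
    moreover have "open ((\<lambda>r. r t) -` ball (rho \<sigma> q z t) \<epsilon> :: (real \<Rightarrow> 'a) set)"
      by (intro open_vimage continuous_on_product_coordinates open_ball)
    ultimately show "openin (top_of_set (P \<inter> R)) (J -` U \<inter> topspace (top_of_set (P \<inter> R)))"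
      by (simp add: openin_open_Int)
  next
    have "J ` topspace (top_of_set (P \<inter> R)) \<subseteq> topspace (sigma_topology \<sigma> q)" using J by auto
    then show "J ` topspace (top_of_set (P \<inter> R)) \<subseteq> \<Union> {sigma_nbhd \<sigma> q z t \<epsilon> |z t \<epsilon>. z \<in> sigma_bar \<sigma> \<and> 0 \<le> t \<and> 0 < \<epsilon>}"
      by (simp only: sigma_topology_def topology_generated_by_topspace)
  qed
  moreover have "compactin (top_of_set (P \<inter> R)) (P \<inter> R)"
    using PR by (simp add: compactin_subtopology)
  ultimately have "compactin (sigma_topology \<sigma> q) (J ` (P \<inter> R))" by (rule image_compactin[rotated])
  moreover have "J ` (P \<inter> R) = sigma_bar \<sigma>"
  proof
    show "J ` (P \<inter> R) \<subseteq> sigma_bar \<sigma>" using J by blast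
    show "sigma_bar \<sigma> \<subseteq> J ` (P \<inter> R)"
    proof
      fix z assume z: "z \<in> sigma_bar \<sigma>"
      define r where "r t = (if 0 \<le> t then rho \<sigma> q z t else q)" for t
      have "r s = proj q s (r t)" if "0 \<le> s" "s \<le> t" for s t
        using rho_eq_proj[OF z that] that by (simp add: r_def)
      then have r: "r \<in> P \<inter> R"
        using dist_rho_le[OF z] unfolding P_def R_def by (auto simp: r_def)
      have "J r = z" using rho_injective[OF J(1)[OF r] z, of q] J(2)[OF r] by (simp add: r_def)
      then show "z \<in> J ` (P \<inter> R)" using r by blast
    qed
  qed
  ultimately show ?thesis by (simp add: compact_space_def)
qed

text \<open>Continuity on the compactification is uniform continuity for the pseudometrics
  \<open>dist (rho \<sigma> q z T) (rho \<sigma> q w T)\<close>, which increase with \<open>T\<close> up to a factor of 2.\<close>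

lemma continuous_map_sigma_topology_iff:
  fixes F :: "'a sigma_point \<Rightarrow> 'b::metric_space"
  shows "continuous_map (sigma_topology \<sigma> q) euclidean F \<longleftrightarrow>
    (\<forall>\<epsilon>>0. \<exists>T\<ge>0. \<exists>\<delta>>0. \<forall>z\<in>sigma_bar \<sigma>. \<forall>w\<in>sigma_bar \<sigma>.
       dist (rho \<sigma> q z T) (rho \<sigma> q w T) < \<delta> \<longrightarrow> dist (F z) (F w) < \<epsilon>)" (is "?L \<longleftrightarrow> ?R")
proof
  assume R: ?R
  have "openin (sigma_topology \<sigma> q) {z \<in> sigma_bar \<sigma>. F z \<in> U}" if U: "open U" for U
  proof (subst openin_subopen, intro ballI)
    fix z assume z: "z \<in> {z \<in> sigma_bar \<sigma>. F z \<in> U}"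
    then obtain \<epsilon> where \<epsilon>: "0 < \<epsilon>" "ball (F z) \<epsilon> \<subseteq> U"
      using openE[OF U, of "F z"] by blast
    obtain T \<delta> where T: "0 \<le> T" "0 < \<delta>" "\<forall>z\<in>sigma_bar \<sigma>. \<forall>w\<in>sigma_bar \<sigma>.
       dist (rho \<sigma> q z T) (rho \<sigma> q w T) < \<delta> \<longrightarrow> dist (F z) (F w) < \<epsilon>"
      using R[rule_format, OF \<epsilon>(1)] by blast
    have "openin (sigma_topology \<sigma> q) (sigma_nbhd \<sigma> q z T \<delta>)" "z \<in> sigma_nbhd \<sigma> q z T \<delta>"
      using z T by (auto simp: openin_sigma_nbhd)
    moreover have "sigma_nbhd \<sigma> q z T \<delta> \<subseteq> {z \<in> sigma_bar \<sigma>. F z \<in> U}"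
    proof
      fix w assume "w \<in> sigma_nbhd \<sigma> q z T \<delta>"
      then have w: "w \<in> sigma_bar \<sigma>" "dist (rho \<sigma> q z T) (rho \<sigma> q w T) < \<delta>"
        by (auto simp: sigma_nbhd_def dist_commute)
      then have "F w \<in> ball (F z) \<epsilon>" using T(3) z by simp
      then show "w \<in> {z \<in> sigma_bar \<sigma>. F z \<in> U}" using \<epsilon>(2) w(1) by blast
    qed
    ultimately show "\<exists>V. openin (sigma_topology \<sigma> q) V \<and> z \<in> V \<and> V \<subseteq> {z \<in> sigma_bar \<sigma>. F z \<in> U}"
      by blast
  qed
  then show ?L by (simp add: continuous_map)
next
  assume L: ?L
  show ?R
  proof (intro allI impI)
    fix \<epsilon> :: real assume \<epsilon>: "0 < \<epsilon>"
    \<comment> \<open>A Lebesgue number argument: the cover uses radius \<delta>, while F is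
      controlled on radius 2 \<delta>, which leaves room for a second point near the first.\<close>
    have "\<exists>t\<ge>0. \<exists>\<delta>>0. \<forall>w\<in>sigma_nbhd \<sigma> q z t (2 * \<delta>). dist (F w) (F z) < \<epsilon> / 2"
      if z: "z \<in> sigma_bar \<sigma>" for z
    proof -
      have "openin (sigma_topology \<sigma> q) {w \<in> topspace (sigma_topology \<sigma> q). F w \<in> ball (F z) (\<epsilon> / 2)}"
        by (rule openin_continuous_map_preimage[OF L]) simp
      moreover have "z \<in> {w \<in> topspace (sigma_topology \<sigma> q). F w \<in> ball (F z) (\<epsilon> / 2)}"
        using z \<epsilon> by simp
      ultimately obtain t e where "0 \<le> t" "0 < e"
        "sigma_nbhd \<sigma> q z t e \<subseteq> {w \<in> topspace (sigma_topology \<sigma> q). F w \<in> ball (F z) (\<epsilon> / 2)}"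
        using sigma_topology_nbhd_base by meson
      then show ?thesis
        by (intro exI[of _ t] conjI exI[of _ "e / 2"]) (auto simp: dist_commute)
    qed
    then obtain t \<delta> where t: "\<And>z. z \<in> sigma_bar \<sigma> \<Longrightarrow> 0 \<le> t z"
      "\<And>z. z \<in> sigma_bar \<sigma> \<Longrightarrow> 0 < \<delta> z"
      and F: "\<And>z w. z \<in> sigma_bar \<sigma> \<Longrightarrow> w \<in> sigma_nbhd \<sigma> q z (t z) (2 * \<delta> z) \<Longrightarrow> dist (F w) (F z) < \<epsilon> / 2"
      by metis
    let ?N = "\<lambda>z. sigma_nbhd \<sigma> q z (t z) (\<delta> z)"
    have "openin (sigma_topology \<sigma> q) U" if "U \<in> ?N ` sigma_bar \<sigma>" for U
      using that t openin_sigma_nbhd by auto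
    moreover have "sigma_bar \<sigma> \<subseteq> \<Union>(?N ` sigma_bar \<sigma>)"
      using t by (auto intro: mem_sigma_nbhd)
    ultimately obtain \<F> where \<F>: "finite \<F>" "\<F> \<subseteq> ?N ` sigma_bar \<sigma>" "sigma_bar \<sigma> \<subseteq> \<Union>\<F>"
      using compactinD[of "sigma_topology \<sigma> q" "sigma_bar \<sigma>" "?N ` sigma_bar \<sigma>"]
        compact_space_sigma_topology[of q] unfolding compact_space_def topspace_sigma_topology by blast
    obtain Z where Z: "Z \<subseteq> sigma_bar \<sigma>" "finite Z" "\<F> = ?N ` Z"
      using finite_subset_image[OF \<F>(1,2)] by blast
    define T where "T = Max (insert 0 (t ` Z))"
    \<comment> \<open>The half again pays for \<open>dist_rho_mono\<close>. The inserted 1, like the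
      0 in T, covers an empty Z.\<close>
    define d where "d = Min (insert 1 (\<delta> ` Z)) / 2"
    have T: "0 \<le> T" "\<And>z. z \<in> Z \<Longrightarrow> t z \<le> T" using Z by (auto simp: T_def)
    have "0 < Min (insert 1 (\<delta> ` Z))" using Z t by (subst Min_gr_iff) auto
    moreover have "Min (insert 1 (\<delta> ` Z)) \<le> \<delta> z" if "z \<in> Z" for z using Z that by auto
    ultimately have d: "0 < d" "\<And>z. z \<in> Z \<Longrightarrow> 2 * d \<le> \<delta> z" by (auto simp: d_def)
    have "dist (F w) (F w') < \<epsilon>"
      if w: "w \<in> sigma_bar \<sigma>" "w' \<in> sigma_bar \<sigma>" "dist (rho \<sigma> q w T) (rho \<sigma> q w' T) < d" for w w'
    proof -
      obtain z where z: "z \<in> Z" "w \<in> ?N z" using \<F>(3) Z(3) w(1) by blast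
      have zb: "z \<in> sigma_bar \<sigma>" using z Z by blast
      have "dist (rho \<sigma> q w' (t z)) (rho \<sigma> q w (t z)) \<le> 2 * dist (rho \<sigma> q w' T) (rho \<sigma> q w T)"
        using dist_rho_mono[OF w(2,1) t(1)[OF zb] T(2)[OF z(1)]] .
      also have "\<dots> < \<delta> z" using w(3) d(2)[OF z(1)] by (simp add: dist_commute)
      finally have "dist (rho \<sigma> q w' (t z)) (rho \<sigma> q z (t z)) < 2 * \<delta> z"
        using dist_triangle[of "rho \<sigma> q w' (t z)" "rho \<sigma> q z (t z)" "rho \<sigma> q w (t z)"] z(2)
        by (simp add: sigma_nbhd_def)
      then have "dist (F w') (F z) < \<epsilon> / 2" using F[OF zb, of w'] w by (simp add: sigma_nbhd_def)
      moreover have "dist (F w) (F z) < \<epsilon> / 2"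
        using F[OF zb, of w] z(2) t(2)[OF zb] by (simp add: sigma_nbhd_def)
      ultimately show ?thesis by (rule dist_triangle_half_l[rotated])
    qed
    then show "\<exists>T\<ge>0. \<exists>\<delta>>0. \<forall>z\<in>sigma_bar \<sigma>. \<forall>w\<in>sigma_bar \<sigma>.
       dist (rho \<sigma> q z T) (rho \<sigma> q w T) < \<delta> \<longrightarrow> dist (F z) (F w) < \<epsilon>" using T(1) d(1) by blast
  qed
qed

end


subsection \<open>Continuous extension to the ray compactification\<close>

definition slowly_oscillating :: "('a::metric_space \<Rightarrow> complex) \<Rightarrow> bool" where
  "slowly_oscillating f \<longleftrightarrow>
     (\<forall>R>0. \<forall>\<epsilon>>0. \<exists>K. compact K \<and> (\<forall>x y. x \<notin> K \<longrightarrow> dist x y \<le> R \<longrightarrow> cmod (f y - f x) < \<epsilon>))"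

text \<open>A real supremum bounds its family only when the family is bounded above, which
  boundedness of f provides. Conversely a strict pointwise bound gives only a weak bound on the
  supremum, hence \<epsilon> / 2.\<close>

lemma combing_algebra_iff:
  "f \<in> combing_algebra S \<longleftrightarrow> continuous_on UNIV f \<and> bounded (range f) \<and>
     uniform_limit UNIV (\<lambda>n x. f (S x n)) f sequentially \<and> slowly_oscillating f"
proof -
  have "(\<forall>R>0. \<forall>\<epsilon>>0. \<exists>K. compact K \<and> (\<forall>x. x \<notin> K \<longrightarrow> (SUP y\<in>cball x R. cmod (f y - f x)) < \<epsilon>))
      \<longleftrightarrow> slowly_oscillating f" (is "?V \<longleftrightarrow> _") if bd: "bounded (range f)"
  proof
    obtain B where "\<forall>y\<in>range f. cmod y \<le> B" using bd unfolding bounded_iff by blast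
    then have B: "\<And>x. cmod (f x) \<le> B" by blast
    have bdd: "bdd_above ((\<lambda>y. cmod (f y - f x)) ` cball x R)" for x R
    proof (rule bdd_aboveI2)
      fix y show "cmod (f y - f x) \<le> B + B"
        using norm_triangle_ineq4[of "f y" "f x"] B[of x] B[of y] by linarith
    qed
    show "slowly_oscillating f" if V: ?V
      unfolding slowly_oscillating_def
    proof (intro allI impI)
      fix R \<epsilon> :: real assume "0 < R" "0 < \<epsilon>"
      then obtain K where K: "compact K" "\<And>x. x \<notin> K \<Longrightarrow> (SUP y\<in>cball x R. cmod (f y - f x)) < \<epsilon>"
        using V by blast
      have "cmod (f y - f x) < \<epsilon>" if "x \<notin> K" "dist x y \<le> R" for x y
      proof -
        have "cmod (f y - f x) \<le> (SUP y\<in>cball x R. cmod (f y - f x))"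
          by (rule cSUP_upper[OF _ bdd]) (use that in simp)
        then show ?thesis using K(2)[OF that(1)] by simp
      qed
      then show "\<exists>K. compact K \<and> (\<forall>x y. x \<notin> K \<longrightarrow> dist x y \<le> R \<longrightarrow> cmod (f y - f x) < \<epsilon>)"
        using K(1) by blast
    qed
    show ?V if S: "slowly_oscillating f"
    proof (intro allI impI)
      fix R \<epsilon> :: real assume "0 < R" "0 < \<epsilon>"
      then have "0 < \<epsilon> / 2" by simp
      with \<open>0 < R\<close> obtain K
        where K: "compact K" "\<And>x y. x \<notin> K \<Longrightarrow> dist x y \<le> R \<Longrightarrow> cmod (f y - f x) < \<epsilon> / 2"
        using S unfolding slowly_oscillating_def by meson
      have "(SUP y\<in>cball x R. cmod (f y - f x)) < \<epsilon>" if "x \<notin> K" for x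
      proof -
        have "(SUP y\<in>cball x R. cmod (f y - f x)) \<le> \<epsilon> / 2"
          using K(2)[OF that] \<open>0 < R\<close> by (intro cSUP_least) (auto intro: less_imp_le)
        then show ?thesis using \<open>0 < \<epsilon>\<close> by simp
      qed
      then show "\<exists>K. compact K \<and> (\<forall>x. x \<notin> K \<longrightarrow> (SUP y\<in>cball x R. cmod (f y - f x)) < \<epsilon>)"
        using K(1) by blast
    qed
  qed
  then show ?thesis by (auto simp: combing_algebra_def)
qed

context bicombed_space
begin

text \<open>By properness the closed balls about q are compact, and every compact set lies in one of
  them.\<close>

lemma slowly_oscillating_iff:
  fixes f :: "'a \<Rightarrow> complex"
  shows "slowly_oscillating f \<longleftrightarrow>
     (\<forall>R>0. \<forall>\<epsilon>>0. \<exists>M\<ge>0. \<forall>x y. M < dist q x \<longrightarrow> dist x y \<le> R \<longrightarrow> cmod (f y - f x) < \<epsilon>)"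
  (is "?L \<longleftrightarrow> ?R")
proof
  assume ?L
  show ?R
  proof (intro allI impI)
    fix R \<epsilon> :: real assume "0 < R" "0 < \<epsilon>"
    then obtain K where K: "compact K" "\<And>x y. x \<notin> K \<Longrightarrow> dist x y \<le> R \<Longrightarrow> cmod (f y - f x) < \<epsilon>"
      using \<open>?L\<close> unfolding slowly_oscillating_def by meson
    obtain M where "\<And>x. x \<in> K \<Longrightarrow> dist q x \<le> M"
      using compact_imp_bounded[OF K(1)] bounded_any_center[of K q] by blast
    then have "x \<notin> K" if "max M 0 < dist q x" for x using that by fastforce
    then show "\<exists>M\<ge>0. \<forall>x y. M < dist q x \<longrightarrow> dist x y \<le> R \<longrightarrow> cmod (f y - f x) < \<epsilon>"
      using K(2) by (intro exI[of _ "max M 0"]) auto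
  qed
next
  assume ?R
  show ?L
    unfolding slowly_oscillating_def
  proof (intro allI impI)
    fix R \<epsilon> :: real assume "0 < R" "0 < \<epsilon>"
    then obtain M where "\<And>x y. M < dist q x \<Longrightarrow> dist x y \<le> R \<Longrightarrow> cmod (f y - f x) < \<epsilon>"
      using \<open>?R\<close> by meson
    then show "\<exists>K. compact K \<and> (\<forall>x y. x \<notin> K \<longrightarrow> dist x y \<le> R \<longrightarrow> cmod (f y - f x) < \<epsilon>)"
      using proper[of q M] by (intro exI[of _ "cball q M"]) auto
  qed
qed

text \<open>What is retained of a combing, possibly with another basepoint. Bounded distance is
  useful only far out, where slow oscillation acts; the second clause handles bounded sets.\<close>

definition tracks :: "'a \<Rightarrow> ('a \<Rightarrow> nat \<Rightarrow> 'a) \<Rightarrow> bool" where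
  "tracks q S \<longleftrightarrow> (\<exists>C. \<forall>x n. dist (S x n) (proj q (real n) x) \<le> C) \<and>
     (\<forall>R. \<exists>N. \<forall>n\<ge>N. \<forall>x. dist q x \<le> R \<longrightarrow> S x n = x)"

lemma tracks_close:
  assumes "tracks q S" "slowly_oscillating f" "0 < \<epsilon>"
  shows "\<exists>N. \<forall>n\<ge>N. \<forall>x. dist (f (S x n)) (f (proj q (real n) x)) < \<epsilon>"
proof -
  obtain C where C: "\<And>x n. dist (S x n) (proj q (real n) x) \<le> C" using assms(1) by (auto simp: tracks_def)
  have "0 < \<bar>C\<bar> + 1" by simp
  then obtain M where M: "0 \<le> M" "\<And>x y. M < dist q x \<Longrightarrow> dist x y \<le> \<bar>C\<bar> + 1 \<Longrightarrow> cmod (f y - f x) < \<epsilon>"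
    using assms(2,3) unfolding slowly_oscillating_iff[of f q] by meson
  obtain N where N: "\<And>n x. N \<le> n \<Longrightarrow> dist q x \<le> M \<Longrightarrow> S x n = x"
    using assms(1) unfolding tracks_def by meson
  \<comment> \<open>The condition n > M ensures that a point outside radius M still lies outside it
    after projection to radius n.\<close>
  have "dist (f (S x n)) (f (proj q (real n) x)) < \<epsilon>" if n: "max N (nat \<lceil>M\<rceil> + 1) \<le> n" for n x
  proof (cases "dist q x \<le> M")
    case True
    then have "S x n = x" "proj q (real n) x = x"
      using N[of n x] n by (auto intro!: proj_self) linarith
    then show ?thesis using assms(3) by simp
  next
    case False
    have "M < real n" using n by linarith
    then have "M < dist q (proj q (real n) x)" using False dist_proj_start[of "real n" q x] by simp
    moreover have "dist (proj q (real n) x) (S x n) \<le> \<bar>C\<bar> + 1"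
      using C[of x n] by (simp add: dist_commute)
    ultimately show ?thesis using M(2) by (simp add: dist_norm)
  qed
  then show ?thesis by blast
qed

text \<open>The combing enters the algebra only through the uniform limit, and for slowly
  oscillating f the two sequences of functions differ uniformly little.\<close>

lemma combing_algebra_tracks:
  assumes "tracks q S"
  shows "combing_algebra S = combing_algebra (bicombing_combing \<sigma> q)"
proof -
  have transfer: "uniform_limit UNIV (\<lambda>n x. f (T' x n)) f sequentially"
    if close: "\<And>\<epsilon>::real. 0 < \<epsilon> \<Longrightarrow> \<exists>N. \<forall>n\<ge>N. \<forall>x. dist (f (T' x n)) (f (T x n)) < \<epsilon>"
      and lim: "uniform_limit UNIV (\<lambda>n x. f (T x n)) f sequentially"
    for f :: "'a \<Rightarrow> complex" and T T'
    unfolding uniform_limit_sequentially_iff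
  proof (intro allI impI)
    fix \<epsilon> :: real assume "0 < \<epsilon>"
    then have "0 < \<epsilon> / 2" by simp
    then obtain N N' where "\<forall>n\<ge>N. \<forall>x. dist (f (T' x n)) (f (T x n)) < \<epsilon> / 2"
      "\<forall>n\<ge>N'. \<forall>x\<in>UNIV. dist (f (T x n)) (f x) < \<epsilon> / 2"
      using close lim unfolding uniform_limit_sequentially_iff by meson
    then have "dist (f (T' x n)) (f x) < \<epsilon>" if "max N N' \<le> n" for n x
      using that dist_triangle_half_r[of "f (T x n)" "f (T' x n)" \<epsilon> "f x"] by (simp add: dist_commute)
    then show "\<exists>N. \<forall>n\<ge>N. \<forall>x\<in>UNIV. dist (f (T' x n)) (f x) < \<epsilon>" by blast
  qed
  have "uniform_limit UNIV (\<lambda>n x. f (S x n)) f sequentially \<longleftrightarrow>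
      uniform_limit UNIV (\<lambda>n x. f (bicombing_combing \<sigma> q x n)) f sequentially"
    if "slowly_oscillating f" for f
    using transfer[of f S "bicombing_combing \<sigma> q"] transfer[of f "bicombing_combing \<sigma> q" S]
      tracks_close[OF assms that]
    by (auto simp: bicombing_combing_def proj_def[symmetric] dist_commute)
  then show ?thesis by (auto simp: combing_algebra_iff)
qed

section \<open>Extension of functions by radial limits\<close>

definition extend :: "'a \<Rightarrow> ('a \<Rightarrow> complex) \<Rightarrow> 'a sigma_point \<Rightarrow> complex" where
  "extend q f z = lim (\<lambda>n. f (rho \<sigma> q z (real n)))"

lemma extend_Inl [simp]: "extend q f (Inl x) = f x"
proof -
  have "\<forall>\<^sub>F n in sequentially. f (rho \<sigma> q (Inl x) (real n)) = f x"
    using eventually_ge_at_top[of "nat \<lceil>dist q x\<rceil>"]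
  proof eventually_elim
    case (elim n)
    then have "dist q x \<le> real n" by linarith
    then show ?case by (simp add: rho_Inl_eq_self)
  qed
  then show ?thesis unfolding extend_def by (intro limI tendsto_eventually)
qed

text \<open>Projecting \<open>rho \<sigma> q z m\<close> to radius n gives
  \<open>rho \<sigma> q z n\<close> for n \<le> m. So uniform convergence on X, read at the points
  of a ray, is the uniform Cauchy condition on the whole compactification.\<close>

lemma uniform_limit_extend:
  assumes "f \<in> combing_algebra (bicombing_combing \<sigma> q)"
  shows "uniform_limit (sigma_bar \<sigma>) (\<lambda>n z. f (rho \<sigma> q z (real n))) (extend q f) sequentially"
proof -
  have "uniformly_Cauchy_on (sigma_bar \<sigma>) (\<lambda>n z. f (rho \<sigma> q z (real n)))"
  proof (rule uniformly_Cauchy_onI')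
    fix \<epsilon> :: real assume "0 < \<epsilon>"
    then obtain N where N: "\<And>n x. N \<le> n \<Longrightarrow> dist (f (proj q (real n) x)) (f x) < \<epsilon>"
      using assms unfolding combing_algebra_iff uniform_limit_sequentially_iff bicombing_combing_def proj_def
      by (meson UNIV_I)
    have "dist (f (rho \<sigma> q z (real n))) (f (rho \<sigma> q z (real m))) < \<epsilon>"
      if "z \<in> sigma_bar \<sigma>" "N \<le> n" "n < m" for z m n
      using N[OF that(2), of "rho \<sigma> q z (real m)"] rho_eq_proj[OF that(1), of "real n" "real m" q] that
      by simp
    then show "\<exists>M. \<forall>x\<in>sigma_bar \<sigma>. \<forall>m\<ge>M. \<forall>n>m.
        dist (f (rho \<sigma> q x (real m))) (f (rho \<sigma> q x (real n))) < \<epsilon>" by blast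
  qed
  then show ?thesis
    unfolding extend_def using Cauchy_uniformly_convergent uniformly_convergent_uniform_limit_iff by blast
qed

text \<open>The extension is a uniform limit of functions that factor through a ball about q, where
  f is uniformly continuous by compactness; the index n serves as the radius T.\<close>

lemma continuous_map_extend:
  assumes "f \<in> combing_algebra (bicombing_combing \<sigma> q)"
  shows "continuous_map (sigma_topology \<sigma> q) euclidean (extend q f)"
  unfolding continuous_map_sigma_topology_iff
proof (intro allI impI)
  fix \<epsilon> :: real assume "0 < \<epsilon>"
  then have "0 < \<epsilon> / 3" by simp
  then obtain n where n: "\<And>z. z \<in> sigma_bar \<sigma> \<Longrightarrow> dist (f (rho \<sigma> q z (real n))) (extend q f z) < \<epsilon> / 3"
    using uniform_limit_extend[OF assms] unfolding uniform_limit_sequentially_iff by blast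
  have "continuous_on (cball q (real n)) f"
    using assms continuous_on_subset unfolding combing_algebra_iff by blast
  then have "uniformly_continuous_on (cball q (real n)) f"
    using proper by (rule compact_uniformly_continuous)
  then obtain \<delta> where \<delta>: "0 < \<delta>" "\<And>x y. x \<in> cball q (real n) \<Longrightarrow> y \<in> cball q (real n) \<Longrightarrow>
      dist x y < \<delta> \<Longrightarrow> dist (f x) (f y) < \<epsilon> / 3"
    using \<open>0 < \<epsilon> / 3\<close> unfolding uniformly_continuous_on_def by (metis dist_commute)
  have "dist (extend q f z) (extend q f w) < \<epsilon>"
    if "z \<in> sigma_bar \<sigma>" "w \<in> sigma_bar \<sigma>" "dist (rho \<sigma> q z (real n)) (rho \<sigma> q w (real n)) < \<delta>" for z w
  proof -
    let ?a = "f (rho \<sigma> q z (real n))" and ?b = "f (rho \<sigma> q w (real n))"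
    have "dist ?a ?b < \<epsilon> / 3" using \<delta>(2) dist_rho_le[OF that(1)] dist_rho_le[OF that(2)] that(3) by simp
    then show ?thesis
      using n[OF that(1)] n[OF that(2)] dist_triangle[of "extend q f z" "extend q f w" ?a]
        dist_triangle[of ?a "extend q f w" ?b] by (simp add: dist_commute)
  qed
  then show "\<exists>T\<ge>0. \<exists>\<delta>>0. \<forall>z\<in>sigma_bar \<sigma>. \<forall>w\<in>sigma_bar \<sigma>.
      dist (rho \<sigma> q z T) (rho \<sigma> q w T) < \<delta> \<longrightarrow> dist (extend q f z) (extend q f w) < \<epsilon>"
    using \<delta>(1) by (intro exI[of _ "real n"]) auto
qed

lemma rho_rho:
  assumes "z \<in> sigma_bar \<sigma>" "0 \<le> s" "s \<le> t"
  shows "rho \<sigma> q (Inl (rho \<sigma> q z t)) s = rho \<sigma> q z s"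
  using rho_eq_proj[OF assms, of q] by (simp add: proj_def)

text \<open>Up to \<epsilon> the value of F depends only on the projection to one radius T. This
  projection does not distinguish x from its projection to radius n \<ge> T, and far out it
  contracts bounded distances below any \<delta>.\<close>

lemma restrict_continuous_map_mem:
  assumes F: "continuous_map (sigma_topology \<sigma> q) euclidean F"
  shows "F \<circ> Inl \<in> combing_algebra (bicombing_combing \<sigma> q)"
proof -
  have unif: "\<exists>T\<ge>0. \<exists>\<delta>>0. \<forall>x y. dist (proj q T x) (proj q T y) < \<delta> \<longrightarrow> dist (F (Inl x)) (F (Inl y)) < \<epsilon>"
    if "0 < \<epsilon>" for \<epsilon>
    using F that unfolding continuous_map_sigma_topology_iff proj_def by (meson sigma_bar_Inl)
  have "continuous_on UNIV (F \<circ> Inl)"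
    unfolding continuous_on_iff
  proof (intro ballI allI impI)
    fix x and \<epsilon> :: real assume "0 < \<epsilon>"
    then obtain T \<delta> where T: "0 \<le> T" "0 < \<delta>"
      "\<And>x y. dist (proj q T x) (proj q T y) < \<delta> \<Longrightarrow> dist (F (Inl x)) (F (Inl y)) < \<epsilon>" using unif by meson
    have "dist (F (Inl y)) (F (Inl x)) < \<epsilon>" if "dist y x < \<delta> / 2" for y
      using T(3) dist_proj_proj_le[OF T(1), of q y x] that by simp
    then show "\<exists>d>0. \<forall>x'\<in>UNIV. dist x' x < d \<longrightarrow> dist ((F \<circ> Inl) x') ((F \<circ> Inl) x) < \<epsilon>"
      using T(2) by (intro exI[of _ "\<delta> / 2"]) auto
  qed
  moreover have "bounded (range (F \<circ> Inl))"
  proof -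
    have "compactin euclidean (F ` sigma_bar \<sigma>)"
      using image_compactin[OF _ F] compact_space_sigma_topology[of q] by (simp add: compact_space_def)
    then have "bounded (F ` sigma_bar \<sigma>)" by (simp add: compact_imp_bounded)
    then show ?thesis by (rule bounded_subset) auto
  qed
  moreover have "uniform_limit UNIV (\<lambda>n x. (F \<circ> Inl) (bicombing_combing \<sigma> q x n)) (F \<circ> Inl) sequentially"
    unfolding uniform_limit_sequentially_iff
  proof (intro allI impI)
    fix \<epsilon> :: real assume "0 < \<epsilon>"
    then obtain T \<delta> where T: "0 \<le> T" "0 < \<delta>"
      "\<And>x y. dist (proj q T x) (proj q T y) < \<delta> \<Longrightarrow> dist (F (Inl x)) (F (Inl y)) < \<epsilon>" using unif by meson
    have "dist (F (Inl (proj q (real n) x))) (F (Inl x)) < \<epsilon>" if "nat \<lceil>T\<rceil> \<le> n" for n x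
    proof -
      have "T \<le> real n" using that by linarith
      then show ?thesis using T proj_proj[of T "real n" q x] by (simp add: min_def)
    qed
    then show "\<exists>N. \<forall>n\<ge>N. \<forall>x\<in>UNIV. dist ((F \<circ> Inl) (bicombing_combing \<sigma> q x n)) ((F \<circ> Inl) x) < \<epsilon>"
      unfolding bicombing_combing_def comp_def proj_def by blast
  qed
  moreover have "slowly_oscillating (F \<circ> Inl)"
    unfolding slowly_oscillating_iff[of _ q]
  proof (intro allI impI)
    fix R \<epsilon> :: real assume "0 < R" "0 < \<epsilon>"
    then obtain T \<delta> where T: "0 \<le> T" "0 < \<delta>"
      "\<And>x y. dist (proj q T x) (proj q T y) < \<delta> \<Longrightarrow> dist (F (Inl x)) (F (Inl y)) < \<epsilon>" using unif by meson
    \<comment> \<open>Makes 2 (T / L) R < \<delta>. The threshold used below is L + R, so that a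
      point within R of x also lies outside radius L.\<close>
    define L where "L = T + 2 * T * R / \<delta> + 1"
    have "0 \<le> 2 * T * R / \<delta>" using T \<open>0 < R\<close> by simp
    then have L: "T \<le> L" "0 < L" "2 * T * R / \<delta> < L" using T by (auto simp: L_def)
    have "cmod (F (Inl y) - F (Inl x)) < \<epsilon>" if "L + R < dist q x" "dist x y \<le> R" for x y
    proof -
      have "L \<le> dist q x" "L \<le> dist q y"
        using that \<open>0 < R\<close> dist_triangle[of q x y] by (auto simp: dist_commute)
      then have "dist (proj q T y) (proj q T x) \<le> 2 * (T / L) * dist y x"
        using dist_proj_proj_le_ratio[of T L q y x] T L by simp
      also have "\<dots> \<le> 2 * (T / L) * R" using that T L by (intro mult_left_mono) (auto simp: dist_commute)
      also have "\<dots> < \<delta>" using L T by (simp add: field_simps)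
      finally show ?thesis using T(3) by (simp add: dist_norm)
    qed
    then show "\<exists>M\<ge>0. \<forall>x y. M < dist q x \<longrightarrow> dist x y \<le> R \<longrightarrow> cmod ((F \<circ> Inl) y - (F \<circ> Inl) x) < \<epsilon>"
      using L \<open>0 < R\<close> by (intro exI[of _ "L + R"]) auto
  qed
  ultimately show ?thesis unfolding combing_algebra_iff by blast
qed

text \<open>For n \<ge> T the interior point \<open>rho \<sigma> q z n\<close> has the same
  projection to radius T as z, so F cannot tell them apart up to \<epsilon>. In particular, F is
  determined by its restriction to X.\<close>

lemma extend_restrict:
  assumes F: "continuous_map (sigma_topology \<sigma> q) euclidean F" and z: "z \<in> sigma_bar \<sigma>"
  shows "extend q (F \<circ> Inl) z = F z"
  unfolding extend_def
proof (rule limI, rule LIMSEQ_I)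
  fix \<epsilon> :: real assume "0 < \<epsilon>"
  then obtain T \<delta> where T: "0 \<le> T" "0 < \<delta>" "\<And>z w. z \<in> sigma_bar \<sigma> \<Longrightarrow> w \<in> sigma_bar \<sigma> \<Longrightarrow>
       dist (rho \<sigma> q z T) (rho \<sigma> q w T) < \<delta> \<Longrightarrow> dist (F z) (F w) < \<epsilon>"
    using F unfolding continuous_map_sigma_topology_iff by meson
  have "dist (F (Inl (rho \<sigma> q z (real n)))) (F z) < \<epsilon>" if "nat \<lceil>T\<rceil> \<le> n" for n
  proof -
    have "T \<le> real n" using that by linarith
    then show ?thesis using T rho_rho[OF z T(1), of "real n" q] z by simp
  qed
  then show "\<exists>no. \<forall>n\<ge>no. norm ((F \<circ> Inl) (rho \<sigma> q z (real n)) - F z) < \<epsilon>"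
    unfolding dist_norm comp_def by blast
qed

end


subsection \<open>Gelfand duality\<close>

lemma continuous_map_mult_complex:
  fixes f h :: "'b \<Rightarrow> complex"
  shows "continuous_map K euclidean f \<Longrightarrow> continuous_map K euclidean h \<Longrightarrow>
    continuous_map K euclidean (\<lambda>x. f x * h x)"
  by (simp add: continuous_map_atin tendsto_mult)

text \<open>Otherwise each point z has a function \<open>k z\<close> in the kernel that does not
  vanish at z. The kernel absorbs the factor \<open>cnj (k z)\<close>, so a finite sum of squared
  moduli over a subcover lies in the kernel and vanishes nowhere; being invertible, it contradicts
  \<Psi> 1 = 1. The assumption \<open>cong\<close> makes \<Psi> depend only on values on the space,
  as HOL functions are total.\<close>

lemma character_compact_space_is_evaluation:
  fixes \<Psi> :: "('b \<Rightarrow> complex) \<Rightarrow> complex"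
  assumes K: "compact_space K"
    and cong: "\<And>f h. (\<And>x. x \<in> topspace K \<Longrightarrow> f x = h x) \<Longrightarrow> \<Psi> f = \<Psi> h"
    and add: "\<And>f h. continuous_map K euclidean f \<Longrightarrow> continuous_map K euclidean h \<Longrightarrow>
        \<Psi> (\<lambda>x. f x + h x) = \<Psi> f + \<Psi> h"
    and scale: "\<And>c f. continuous_map K euclidean f \<Longrightarrow> \<Psi> (\<lambda>x. c * f x) = c * \<Psi> f"
    and mult: "\<And>f h. continuous_map K euclidean f \<Longrightarrow> continuous_map K euclidean h \<Longrightarrow>
        \<Psi> (\<lambda>x. f x * h x) = \<Psi> f * \<Psi> h"
    and one: "\<Psi> (\<lambda>x. 1) = 1"
  shows "\<exists>z\<in>topspace K. \<forall>f. continuous_map K euclidean f \<longrightarrow> \<Psi> f = f z"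
proof (rule ccontr)
  assume "\<not> ?thesis"
  then obtain f where f: "\<And>z. z \<in> topspace K \<Longrightarrow> continuous_map K euclidean (f z)"
    and ne: "\<And>z. z \<in> topspace K \<Longrightarrow> \<Psi> (f z) \<noteq> f z z" by metis
  define k where "k z x = f z x - \<Psi> (f z)" for z x
  define h where "h z x = k z x * cnj (k z x)" for z x
  have h_eq: "h z x = complex_of_real ((cmod (k z x))\<^sup>2)" for z x
    unfolding h_def by (rule complex_norm_square[symmetric])
  have k: "continuous_map K euclidean (k z)" if "z \<in> topspace K" for z
    unfolding k_def by (intro continuous_map_diff f that) simp
  have cnj: "continuous_map K euclidean (\<lambda>x. cnj (k z x))" if "z \<in> topspace K" for z
    using k[OF that] by (simp add: continuous_map_atin tendsto_cnj)
  have h: "continuous_map K euclidean (h z)" if "z \<in> topspace K" for z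
    unfolding h_def by (intro continuous_map_mult_complex k cnj that)
  have "\<Psi> (k z) = 0" if z: "z \<in> topspace K" for z
  proof -
    have "\<Psi> (\<lambda>x. f z x + (- \<Psi> (f z)) * 1) = \<Psi> (f z) + (- \<Psi> (f z)) * \<Psi> (\<lambda>x. 1)"
      using add[OF f[OF z], of "\<lambda>x. (- \<Psi> (f z)) * 1"] scale[of "\<lambda>x. 1" "- \<Psi> (f z)"] by simp
    then show ?thesis by (simp add: one k_def[abs_def])
  qed
  then have \<Psi>h: "\<Psi> (h z) = 0" if "z \<in> topspace K" for z
    using mult[OF k[OF that] cnj[OF that]] that by (simp add: h_def[abs_def])
  let ?U = "\<lambda>z. {x \<in> topspace K. h z x \<in> - {0}}"
  have "openin K U" if "U \<in> ?U ` topspace K" for U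
    using that openin_continuous_map_preimage[OF h, of _ "- {0}"] by (auto simp: open_Compl)
  moreover have "topspace K \<subseteq> \<Union>(?U ` topspace K)"
    using ne by (force simp: h_def k_def)
  ultimately obtain \<F> where \<F>: "finite \<F>" "\<F> \<subseteq> ?U ` topspace K" "topspace K \<subseteq> \<Union>\<F>"
    using compactinD[of K "topspace K" "?U ` topspace K"] K unfolding compact_space_def by blast
  obtain Z where Z: "Z \<subseteq> topspace K" "finite Z" "\<F> = ?U ` Z"
    using finite_subset_image[OF \<F>(1,2)] by blast
  define s where "s x = (\<Sum>z\<in>Z. h z x)" for x
  have "continuous_map K euclidean (\<lambda>x. \<Sum>z\<in>Z'. h z x) \<and> \<Psi> (\<lambda>x. \<Sum>z\<in>Z'. h z x) = 0"
    if "finite Z'" "Z' \<subseteq> topspace K" for Z'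
    using that
  proof (induction rule: finite_induct)
    case empty
    show ?case using scale[of "\<lambda>x. 1" 0] by simp
  next
    case (insert z Z')
    then show ?case using h[of z] \<Psi>h[of z] add[of "h z" "\<lambda>x. \<Sum>z\<in>Z'. h z x"]
      by (auto intro!: continuous_map_add)
  qed
  then have s: "continuous_map K euclidean s" "\<Psi> s = 0" using Z by (auto simp: s_def[abs_def])
  have s_ne: "s x \<noteq> 0" if x: "x \<in> topspace K" for x
  proof -
    obtain z where z: "z \<in> Z" "h z x \<noteq> 0" using \<F>(3) Z(3) x by blast
    have "s x = complex_of_real (\<Sum>z\<in>Z. (cmod (k z x))\<^sup>2)" 
      unfolding s_def h_eq of_real_sum ..
    moreover have "(\<Sum>z\<in>Z. (cmod (k z x))\<^sup>2) \<noteq> 0"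
      using z Z(2) by (subst sum_nonneg_eq_0_iff) (auto simp: h_eq)
    ultimately show ?thesis by (metis of_real_eq_0_iff)
  qed
  have inv: "continuous_map K euclidean (\<lambda>x. inverse (s x))"
    using s(1) s_ne by (simp add: continuous_map_atin tendsto_inverse)
  have "\<Psi> (\<lambda>x. s x * inverse (s x)) = \<Psi> (\<lambda>x. 1)" using s_ne by (intro cong) simp
  then show False using mult[OF s(1) inv] s(2) one by simp
qed

context bicombed_space
begin

section \<open>Characters of the bicombing algebra as points of the compactification\<close>

lemma combing_algebra_iff_extends:
  "f \<in> combing_algebra (bicombing_combing \<sigma> q) \<longleftrightarrow>
     (\<exists>F. continuous_map (sigma_topology \<sigma> q) euclidean F \<and> f = F \<circ> Inl)"
proof
  assume "f \<in> combing_algebra (bicombing_combing \<sigma> q)"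
  then show "\<exists>F. continuous_map (sigma_topology \<sigma> q) euclidean F \<and> f = F \<circ> Inl"
    using continuous_map_extend by (intro exI[of _ "extend q f"]) (auto simp: fun_eq_iff)
qed (auto intro: restrict_continuous_map_mem)

definition gelfand_map :: "'a \<Rightarrow> 'a sigma_point \<Rightarrow> ('a \<Rightarrow> complex) \<Rightarrow> complex" where
  "gelfand_map q z = restrict (\<lambda>f. extend q f z) (combing_algebra (bicombing_combing \<sigma> q))"

lemma gelfand_map_Inl:
  "gelfand_map q (Inl x) = evaluation (combing_algebra (bicombing_combing \<sigma> q)) x"
  by (simp add: gelfand_map_def evaluation_def)

lemma gelfand_map_restrict:
  assumes "continuous_map (sigma_topology \<sigma> q) euclidean F" "z \<in> sigma_bar \<sigma>"
  shows "gelfand_map q z (F \<circ> Inl) = F z"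
  using assms by (simp add: gelfand_map_def restrict_continuous_map_mem extend_restrict)

text \<open>Members of the algebra are written as restrictions of continuous functions on the
  compactification, where the operations are pointwise and no limits have to be handled.\<close>

lemma gelfand_map_in_characters:
  assumes z: "z \<in> sigma_bar \<sigma>"
  shows "gelfand_map q z \<in> characters (combing_algebra (bicombing_combing \<sigma> q))"
proof -
  let ?A = "combing_algebra (bicombing_combing \<sigma> q)"
  let ?T = "sigma_topology \<sigma> q"
  have "gelfand_map q z (\<lambda>x. f x + h x) = gelfand_map q z f + gelfand_map q z h \<and>
      gelfand_map q z (\<lambda>x. f x * h x) = gelfand_map q z f * gelfand_map q z h \<and>
      gelfand_map q z (\<lambda>x. c * f x) = c * gelfand_map q z f"
    if fh: "f \<in> ?A" "h \<in> ?A" for f h c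
  proof -
    obtain F H where F: "continuous_map ?T euclidean F" "f = F \<circ> Inl"
      and H: "continuous_map ?T euclidean H" "h = H \<circ> Inl"
      using fh unfolding combing_algebra_iff_extends by blast
    have "continuous_map ?T euclidean (\<lambda>z. F z + H z)" "continuous_map ?T euclidean (\<lambda>z. F z * H z)"
      "continuous_map ?T euclidean (\<lambda>z. c * F z)"
      using F H by (auto intro!: continuous_map_add continuous_map_mult_complex)
    then show ?thesis
      using gelfand_map_restrict[OF F(1) z] gelfand_map_restrict[OF H(1) z]
        gelfand_map_restrict[of q "\<lambda>z. F z + H z" z] gelfand_map_restrict[of q "\<lambda>z. F z * H z" z]
        gelfand_map_restrict[of q "\<lambda>z. c * F z" z] z F(2) H(2) by (simp add: comp_def)
  qed
  moreover have "\<exists>f\<in>?A. gelfand_map q z f \<noteq> 0"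
    using gelfand_map_restrict[of q "\<lambda>_. 1" z] restrict_continuous_map_mem[of q "\<lambda>_. 1"] z
    by (intro bexI[of _ "(\<lambda>_. 1) \<circ> Inl"]) auto
  moreover have "gelfand_map q z \<in> extensional ?A" by (simp add: gelfand_map_def)
  ultimately show ?thesis by (simp add: characters_def)
qed

text \<open>The character is pulled back to F \<mapsto> \<psi>(F \<circ> Inl). Its value at 1 is 1,
  because \<psi> f = \<psi> f * \<psi> 1 for some f with \<psi> f \<noteq> 0.\<close>

lemma gelfand_map_surj:
  assumes \<psi>: "\<psi> \<in> characters (combing_algebra (bicombing_combing \<sigma> q))"
  shows "\<exists>z\<in>sigma_bar \<sigma>. \<psi> = gelfand_map q z"
proof -
  let ?A = "combing_algebra (bicombing_combing \<sigma> q)"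
  let ?T = "sigma_topology \<sigma> q"
  have ext: "\<psi> \<in> extensional ?A"
    and add: "\<And>f h. f \<in> ?A \<Longrightarrow> h \<in> ?A \<Longrightarrow> \<psi> (\<lambda>x. f x + h x) = \<psi> f + \<psi> h"
    and scale: "\<And>c f. f \<in> ?A \<Longrightarrow> \<psi> (\<lambda>x. c * f x) = c * \<psi> f"
    and mult: "\<And>f h. f \<in> ?A \<Longrightarrow> h \<in> ?A \<Longrightarrow> \<psi> (\<lambda>x. f x * h x) = \<psi> f * \<psi> h"
    using \<psi> by (auto simp: characters_def)
  obtain f where f: "f \<in> ?A" "\<psi> f \<noteq> 0" using \<psi> by (auto simp: characters_def)
  have "(\<lambda>_. 1) \<in> ?A" using restrict_continuous_map_mem[of q "\<lambda>_. 1"] by (simp add: comp_def)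
  then have "\<psi> (\<lambda>x. 1) = 1" using mult[OF f(1), of "\<lambda>_. 1"] f(2) by simp
  moreover note restrict_continuous_map_mem[of q]
  ultimately have "\<exists>z\<in>topspace ?T. \<forall>F. continuous_map ?T euclidean F \<longrightarrow> \<psi> (F \<circ> Inl) = F z"
    using add scale mult
    by (intro character_compact_space_is_evaluation compact_space_sigma_topology)
      (auto simp: comp_def intro!: arg_cong[of _ _ \<psi>])
  then obtain z where z: "z \<in> sigma_bar \<sigma>"
    "\<And>F. continuous_map ?T euclidean F \<Longrightarrow> \<psi> (F \<circ> Inl) = F z" by auto
  have "\<psi> = gelfand_map q z"
  proof (rule extensionalityI[OF ext])
    show "gelfand_map q z \<in> extensional ?A" by (simp add: gelfand_map_def)
    fix f assume "f \<in> ?A"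
    then obtain F where "continuous_map ?T euclidean F" "f = F \<circ> Inl"
      unfolding combing_algebra_iff_extends by blast
    then show "\<psi> f = gelfand_map q z f" using z gelfand_map_restrict by simp
  qed
  then show ?thesis using z by blast
qed

lemma gelfand_map_inj: "inj_on (gelfand_map q) (sigma_bar \<sigma>)"
proof (rule inj_onI)
  fix z w assume zw: "z \<in> sigma_bar \<sigma>" "w \<in> sigma_bar \<sigma>" "gelfand_map q z = gelfand_map q w"
  show "z = w"
  proof (rule rho_injective[OF zw(1,2)])
    fix t :: real assume t: "0 \<le> t"
    \<comment> \<open>The separating function: 1-Lipschitz for the pseudometric at radius t, hence
      continuous, and zero at w.\<close>
    define F where "F y = complex_of_real (dist (rho \<sigma> q y t) (rho \<sigma> q w t))" for y
    have "dist (F y) (F y') \<le> dist (rho \<sigma> q y t) (rho \<sigma> q y' t)" for y y'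
    proof -
      have "dist (F y) (F y') = \<bar>dist (rho \<sigma> q y t) (rho \<sigma> q w t) - dist (rho \<sigma> q y' t) (rho \<sigma> q w t)\<bar>"
        by (simp add: F_def dist_norm flip: of_real_diff)
      also have "\<dots> \<le> dist (rho \<sigma> q y t) (rho \<sigma> q y' t)" 
        using abs_dist_diff_le[of "rho \<sigma> q y t" "rho \<sigma> q w t" "rho \<sigma> q y' t"] by (simp add: dist_commute)
      finally show ?thesis .
    qed
    then have "continuous_map (sigma_topology \<sigma> q) euclidean F"
      unfolding continuous_map_sigma_topology_iff using t by (meson le_less_trans)
    then have "F z = F w" using gelfand_map_restrict zw by metis
    then show "rho \<sigma> q z t = rho \<sigma> q w t" by (simp add: F_def)
  qed
qed

lemma homeomorphic_map_gelfand_map: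
  "homeomorphic_map (sigma_topology \<sigma> q)
     (gelfand_topology (combing_algebra (bicombing_combing \<sigma> q))) (gelfand_map q)"
proof (rule continuous_imp_homeomorphic_map)
  let ?A = "combing_algebra (bicombing_combing \<sigma> q)"
  have chars: "topspace (gelfand_topology ?A) = characters ?A"
    by (auto simp: gelfand_topology_def characters_def PiE_def)
  show "compact_space (sigma_topology \<sigma> q)" by (rule compact_space_sigma_topology)
  show "Hausdorff_space (gelfand_topology ?A)"
    by (simp add: gelfand_topology_def Hausdorff_space_subtopology Hausdorff_space_product_topology)
  show "inj_on (gelfand_map q) (topspace (sigma_topology \<sigma> q))" by (simp add: gelfand_map_inj)
  show "gelfand_map q ` topspace (sigma_topology \<sigma> q) = topspace (gelfand_topology ?A)"
    using gelfand_map_in_characters gelfand_map_surj unfolding chars by fastforce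
  have "continuous_map (sigma_topology \<sigma> q) (product_topology (\<lambda>_. euclidean) ?A) (gelfand_map q)"
    unfolding continuous_map_componentwise
  proof (intro conjI ballI)
    show "gelfand_map q ` topspace (sigma_topology \<sigma> q) \<subseteq> extensional ?A"
      by (auto simp: gelfand_map_def)
    fix f assume "f \<in> ?A"
    then show "continuous_map (sigma_topology \<sigma> q) euclidean (\<lambda>z. gelfand_map q z f)"
      using continuous_map_extend[of f q] by (simp add: gelfand_map_def)
  qed
  then show "continuous_map (sigma_topology \<sigma> q) (gelfand_topology ?A) (gelfand_map q)"
    using gelfand_map_in_characters by (auto simp: gelfand_topology_def continuous_map_in_subtopology)
qed

end


subsection \<open>Group actions\<close>

text \<open>The orbits that meet the open ball of radius n about x0 form an increasing open cover of
  the orbit space. A finite subcover, hence a single radius, suffices.\<close>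

lemma geometric_action_coarsely_dense:
  fixes \<phi> :: "'g \<Rightarrow> 'a::metric_space \<Rightarrow> 'a"
  assumes "geometric_action G \<phi>"
  shows "\<exists>D. \<forall>x. \<exists>g\<in>carrier G. dist x (\<phi> g x0) \<le> D"
proof -
  interpret group_action G UNIV \<phi> using assms by (simp add: geometric_action_def)
  interpret group G by (rule group_hom.axioms(1)[OF group_hom])
  have iso: "\<And>g x y. g \<in> carrier G \<Longrightarrow> dist (\<phi> g x) (\<phi> g y) = dist x y"
    and cpt: "compact_space (orbit_topology G \<phi>)"
    using assms by (auto simp: geometric_action_def)
  define U where "U n = {c \<in> orbits G UNIV \<phi>. \<exists>y\<in>c. dist y x0 < real n}" for n :: nat
  have "open {x. orbit G \<phi> x \<in> U n}" for n
  proof -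
    have "continuous_on UNIV (\<phi> g)" if "g \<in> carrier G" for g
      using iso[OF that] unfolding continuous_on_iff by auto
    then have "open (\<Union>g\<in>carrier G. \<phi> g -` ball x0 (real n))"
      by (intro open_UN ballI open_vimage) auto
    moreover have "{x. orbit G \<phi> x \<in> U n} = (\<Union>g\<in>carrier G. \<phi> g -` ball x0 (real n))"
      by (auto simp: U_def orbits_def orbit_def dist_commute)
    ultimately show ?thesis by simp
  qed
  then have "openin (orbit_topology G \<phi>) V" if "V \<in> range U" for V
    using that by (auto simp: openin_orbit_topology U_def)
  moreover have "orbit G \<phi> x \<in> \<Union>(range U)" for x
  proof -
    obtain n :: nat where "dist x x0 < real n" using reals_Archimedean2 by blast
    moreover have "x \<in> orbit G \<phi> x" using orbit_refl[of x] by simp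
    ultimately show ?thesis by (auto simp: U_def orbits_def)
  qed
  moreover have "topspace (orbit_topology G \<phi>) \<subseteq> orbits G UNIV \<phi>"
    using openin_topspace[of "orbit_topology G \<phi>"] unfolding openin_orbit_topology by blast
  ultimately have "\<exists>\<F>. finite \<F> \<and> \<F> \<subseteq> range U \<and> topspace (orbit_topology G \<phi>) \<subseteq> \<Union>\<F>"
    using cpt unfolding compact_space_def by (intro compactinD) (auto simp: orbits_def)
  then obtain J where J: "finite J" "topspace (orbit_topology G \<phi>) \<subseteq> \<Union>(U ` J)"
    by (metis finite_subset_image)
  define N where "N = Max (insert 0 J)"
  have "\<exists>g\<in>carrier G. dist x (\<phi> g x0) \<le> real N" for x
  proof -
    \<comment> \<open>The set of all orbits is itself open, so every orbit belongs to
      \<open>topspace\<close> and is covered.\<close>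
    have "{x. orbit G \<phi> x \<in> orbits G UNIV \<phi>} = UNIV" by (auto simp: orbits_def)
    then have "openin (orbit_topology G \<phi>) (orbits G UNIV \<phi>)"
      unfolding openin_orbit_topology by simp
    then have "orbit G \<phi> x \<in> topspace (orbit_topology G \<phi>)"
      using openin_subset by (fastforce simp: orbits_def)
    then obtain n where n: "n \<in> J" "orbit G \<phi> x \<in> U n" using J by blast
    then obtain g where g: "g \<in> carrier G" "dist (\<phi> g x) x0 < real n"
      by (auto simp: U_def orbit_def)
    have "\<phi> (inv\<^bsub>G\<^esub> g) (\<phi> g x) = x" using orbit_sym_aux[OF g(1)] by simp
    then have "dist x (\<phi> (inv\<^bsub>G\<^esub> g) x0) = dist (\<phi> g x) x0"
      using iso[of "inv\<^bsub>G\<^esub> g" "\<phi> g x" x0] g by simp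
    moreover have "n \<le> N" using n J by (simp add: N_def)
    ultimately have "dist x (\<phi> (inv\<^bsub>G\<^esub> g) x0) \<le> real N" using g(2) by linarith
    then show ?thesis using g(1) by blast
  qed
  then show ?thesis by blast
qed

context bicombed_space
begin

text \<open>Needed because an isometry turns projections centred at q into projections centred at
  its image.\<close>

lemma combing_algebra_basepoint:
  "combing_algebra (bicombing_combing \<sigma> o') = combing_algebra (bicombing_combing \<sigma> q)"
proof (rule combing_algebra_tracks)
  have "dist (bicombing_combing \<sigma> o' x n) (proj q (real n) x) \<le> 2 * dist o' q" for x n
    using dist_proj_basepoint_le[of "real n" o' x q] by (simp add: bicombing_combing_def proj_def)
  moreover have "\<exists>N. \<forall>n\<ge>N. \<forall>x. dist q x \<le> R \<longrightarrow> bicombing_combing \<sigma> o' x n = x" for R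
  proof (intro exI[of _ "nat \<lceil>R + dist o' q\<rceil>"] allI impI)
    fix n x assume "nat \<lceil>R + dist o' q\<rceil> \<le> n" "dist q x \<le> R"
    then have "dist o' x \<le> real n" using dist_triangle[of o' x q] by linarith
    then show "bicombing_combing \<sigma> o' x n = x"
      by (simp add: bicombing_combing_def rho_Inl_eq_self)
  qed
  ultimately show "tracks q (bicombing_combing \<sigma> o')" unfolding tracks_def by blast
qed

end

section \<open>The action of a single group element on functions and rays\<close>

locale bicombed_isometry = bicombed_space +
  fixes i :: "'a \<Rightarrow> 'a"
  assumes isometry: "dist (i x) (i y) = dist x y"
    and equivariant: "t \<in> {0..1} \<Longrightarrow> i (\<sigma> x y t) = \<sigma> (i x) (i y) t"
begin

lemma proj_isometry: "0 \<le> s \<Longrightarrow> i (proj q s x) = proj (i q) s (i x)"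
  using equivariant by (simp add: proj_eq_sigma isometry)

lemma combing_algebra_isometry:
  assumes f: "f \<in> combing_algebra (bicombing_combing \<sigma> q)"
  shows "f \<circ> i \<in> combing_algebra (bicombing_combing \<sigma> q)"
  unfolding combing_algebra_iff
proof (intro conjI)
  have "continuous_on UNIV i" using isometry unfolding continuous_on_iff by auto
  then show "continuous_on UNIV (f \<circ> i)"
    using f continuous_on_compose continuous_on_subset unfolding combing_algebra_iff by blast
  show "bounded (range (f \<circ> i))"
    using f bounded_subset[of "range f" "range (f \<circ> i)"] unfolding combing_algebra_iff by auto
  have f': "f \<in> combing_algebra (bicombing_combing \<sigma> (i q))" using f combing_algebra_basepoint by blast
  show "uniform_limit UNIV (\<lambda>n x. (f \<circ> i) (bicombing_combing \<sigma> q x n)) (f \<circ> i) sequentially"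
    unfolding uniform_limit_sequentially_iff
  proof (intro allI impI)
    fix \<epsilon> :: real assume "0 < \<epsilon>"
    then obtain N where N: "\<forall>n\<ge>N. \<forall>x\<in>UNIV. dist (f (bicombing_combing \<sigma> (i q) x n)) (f x) < \<epsilon>"
      using f' unfolding combing_algebra_iff uniform_limit_sequentially_iff by blast
    have "i (bicombing_combing \<sigma> q x n) = bicombing_combing \<sigma> (i q) (i x) n" for x n
      using proj_isometry[of "real n" q x] by (simp add: bicombing_combing_def proj_def)
    then show "\<exists>N. \<forall>n\<ge>N. \<forall>x\<in>UNIV. dist ((f \<circ> i) (bicombing_combing \<sigma> q x n)) ((f \<circ> i) x) < \<epsilon>"
      using N by (intro exI[of _ N]) simp
  qed
  show "slowly_oscillating (f \<circ> i)"
    unfolding slowly_oscillating_iff[of _ q]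
  proof (intro allI impI)
    fix R \<epsilon> :: real assume "0 < R" "0 < \<epsilon>"
    moreover have "slowly_oscillating f" using f by (simp add: combing_algebra_iff)
    ultimately obtain M where "0 \<le> M"
      "\<And>x y. M < dist (i q) x \<Longrightarrow> dist x y \<le> R \<Longrightarrow> cmod (f y - f x) < \<epsilon>"
      unfolding slowly_oscillating_iff[of f "i q"] by meson
    then show "\<exists>M\<ge>0. \<forall>x y. M < dist q x \<longrightarrow> dist x y \<le> R \<longrightarrow> cmod ((f \<circ> i) y - (f \<circ> i) x) < \<epsilon>"
      by (intro exI[of _ M]) (simp add: isometry)
  qed
qed

abbreviation ray_image :: "(real \<Rightarrow> 'a) \<Rightarrow> real \<Rightarrow> 'a" where
  "ray_image \<xi> \<equiv> restrict (\<lambda>t. i (\<xi> t)) {0..}"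

lemma ray_image_sigma_rays:
  assumes "\<xi> \<in> sigma_rays \<sigma>"
  shows "ray_image \<xi> \<in> sigma_rays \<sigma>"
  unfolding sigma_rays_iff
proof (intro conjI allI impI)
  fix s t :: real assume st: "0 \<le> s \<and> s \<le> t"
  then have "\<xi> s = proj (\<xi> 0) s (\<xi> t)" using sigma_ray_proj[OF assms] by blast
  then have "i (\<xi> s) = i (proj (\<xi> 0) s (\<xi> t))" by (rule arg_cong)
  then show "ray_image \<xi> s = proj (ray_image \<xi> 0) s (ray_image \<xi> t)"
    using st proj_isometry[of s "\<xi> 0" "\<xi> t"] by simp
qed (use sigma_ray_dist[OF assms] in \<open>auto simp: isometry\<close>)

text \<open>Shows that the union in \<open>sigma_act\<close> is one class, independent of the
  representative: an isometry preserves boundedness of the distance between rays.\<close>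

lemma class_ray_image:
  assumes c: "c \<in> sigma_boundary \<sigma>" and \<xi>: "\<xi> \<in> c"
  shows "(\<Union>\<zeta>\<in>c. asymptotic \<sigma> `` {ray_image \<zeta>}) = asymptotic \<sigma> `` {ray_image \<xi>}"
proof -
  obtain \<eta> where "\<eta> \<in> sigma_rays \<sigma>" "c = asymptotic \<sigma> `` {\<eta>}"
    using c by (auto simp: sigma_boundary_def elim: quotientE)
  then have "\<xi> \<in> sigma_rays \<sigma>" "c = asymptotic \<sigma> `` {\<xi>}"
    using \<xi> equiv_class_eq[OF equiv_asymptotic, of \<eta> \<xi>] by (auto simp: asymptotic_iff)
  moreover have "asymptotic \<sigma> `` {ray_image \<zeta>} = asymptotic \<sigma> `` {ray_image \<zeta>'}"
    if "(\<zeta>, \<zeta>') \<in> asymptotic \<sigma>" for \<zeta> \<zeta>'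
  proof (rule equiv_class_eq[OF equiv_asymptotic])
    show "(ray_image \<zeta>, ray_image \<zeta>') \<in> asymptotic \<sigma>"
      using that ray_image_sigma_rays by (simp add: asymptotic_iff isometry)
  qed
  then have "(\<lambda>\<zeta>. asymptotic \<sigma> `` {ray_image \<zeta>}) respects asymptotic \<sigma>"
    by (intro congruentI) blast
  ultimately show ?thesis using UN_equiv_class[OF equiv_asymptotic] by blast
qed

text \<open>Equivariance at the boundary. The image of the ray from q starts at i q, whereas
  \<open>extend\<close> reads f along the ray from q in the image class. The two rays stay at
  bounded distance while leaving every ball, so slow oscillation gives f equal limits along
  them.\<close>

lemma extend_class_ray_image:
  assumes f: "f \<in> combing_algebra (bicombing_combing \<sigma> q)" and c: "c \<in> sigma_boundary \<sigma>"
  defines "c' \<equiv> \<Union>\<zeta>\<in>c. asymptotic \<sigma> `` {ray_image \<zeta>}"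
  shows "extend q f (Inr c') = extend q (f \<circ> i) (Inr c)"
proof -
  let ?\<xi> = "rho \<sigma> q (Inr c)" and ?\<zeta> = "rho \<sigma> q (Inr c')"
  have c'_eq: "c' = asymptotic \<sigma> `` {ray_image ?\<xi>}"
    unfolding c'_def by (rule class_ray_image[OF c rho_boundary(1)[OF c]])
  then have c': "c' \<in> sigma_boundary \<sigma>"
    using ray_image_sigma_rays[OF rho_boundary(3)[OF c]] by (auto simp: sigma_boundary_def intro: quotientI)
  have "(ray_image ?\<xi>, ?\<zeta>) \<in> asymptotic \<sigma>"
    using rho_boundary(1)[OF c'] c'_eq by blast
  then obtain B where B: "\<And>t. 0 \<le> t \<Longrightarrow> dist (i (?\<xi> t)) (?\<zeta> t) \<le> B"
    by (auto simp: asymptotic_iff)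
  have f1: "(\<lambda>n. f (?\<zeta> (real n))) \<longlonglongrightarrow> extend q f (Inr c')"
    using tendsto_uniform_limitI[OF uniform_limit_extend[OF f]] c' by (simp add: sigma_bar_def)
  have f2: "(\<lambda>n. f (i (?\<xi> (real n)))) \<longlonglongrightarrow> extend q (f \<circ> i) (Inr c)"
    using tendsto_uniform_limitI[OF uniform_limit_extend[OF combing_algebra_isometry[OF f]], of "Inr c"] c
    by (simp add: sigma_bar_def)
  have "(\<lambda>n. f (i (?\<xi> (real n))) - f (?\<zeta> (real n))) \<longlonglongrightarrow> 0"
  proof (rule LIMSEQ_I)
    fix \<epsilon> :: real assume \<epsilon>: "0 < \<epsilon>"
    have "slowly_oscillating f" using f by (simp add: combing_algebra_iff)
    moreover have "0 < max B 1" by simp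
    ultimately obtain M where M: "\<And>x y. M < dist q x \<Longrightarrow> dist x y \<le> max B 1 \<Longrightarrow> cmod (f y - f x) < \<epsilon>"
      using \<epsilon> unfolding slowly_oscillating_iff[of f q] by meson
    have "cmod (f (i (?\<xi> (real n))) - f (?\<zeta> (real n)) - 0) < \<epsilon>" if "nat \<lceil>M\<rceil> + 1 \<le> n" for n
    proof -
      have "M < real n" using that by linarith
      then show ?thesis
        using M[of "?\<zeta> (real n)" "i (?\<xi> (real n))"] B[of "real n"] dist_rho_boundary[OF c', of "real n" q]
        by (simp add: dist_commute le_max_iff_disj)
    qed
    then show "\<exists>no. \<forall>n\<ge>no. norm (f (i (?\<xi> (real n))) - f (?\<zeta> (real n)) - 0) < \<epsilon>" by blast
  qed
  from Lim_transform[OF f1 this] show ?thesis by (rule LIMSEQ_unique[OF _ f2])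
qed

end

theorem corollary3p7:
  fixes G :: "('g, 'm) monoid_scheme"
    and \<phi> :: "'g \<Rightarrow> 'a::metric_space \<Rightarrow> 'a"
    and \<sigma> :: "'a \<Rightarrow> 'a \<Rightarrow> real \<Rightarrow> 'a"
    and p q x0 b :: 'a
    and S :: "'g set"
    and \<beta> :: "'a \<Rightarrow> 'g"
    and S' :: "'a \<Rightarrow> nat \<Rightarrow> 'a"
  assumes proper: "\<And>(x::'a) r. compact (cball x r)"
    and geometric: "geometric_action G \<phi>"
    and bicombing: "bicombing \<sigma>" "consistent \<sigma>" "conical \<sigma>" "equivariant_bicombing G \<phi> \<sigma>"
    and generators: "finite S" "S \<subseteq> carrier G" "generate G S = carrier G"
    and quasi_inverse:
      "quasi_inverse (carrier G) (word_dist G S) UNIV dist (\<lambda>g. \<phi> g p) \<beta>"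
    and combing: "combing UNIV dist b S'"
    and morphism:
      "combing_morphism (carrier G)
         (transported_combing (\<lambda>g. \<phi> g p) \<beta> (bicombing_combing \<sigma> p))
         dist S' (\<lambda>g. \<phi> g x0)"
  shows "\<exists>\<tau>. homeomorphic_map (sigma_topology \<sigma> q) (gelfand_topology (combing_algebra S')) \<tau> \<and>
           (\<forall>g\<in>carrier G. \<forall>z\<in>sigma_bar \<sigma>.
              \<tau> (sigma_act \<phi> \<sigma> g z) = gelfand_act \<phi> (combing_algebra S') g (\<tau> z)) \<and>
           (\<forall>x. \<tau> (Inl x) = evaluation (combing_algebra S') x)"
proof -
  have equivariant: "\<And>g x y t. g \<in> carrier G \<Longrightarrow> t \<in> {0..1} \<Longrightarrow> \<phi> g (\<sigma> x y t) = \<sigma> (\<phi> g x) (\<phi> g y) t"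
    using bicombing(4) by (simp add: equivariant_bicombing_def)
  interpret bicombed_space \<sigma>
    using proper bicombing by unfold_locales auto
  have iso: "\<And>g x y. g \<in> carrier G \<Longrightarrow> dist (\<phi> g x) (\<phi> g y) = dist x y"
    using geometric by (auto simp: geometric_action_def)
  obtain D where D: "\<And>x. \<exists>g\<in>carrier G. dist x (\<phi> g x0) \<le> D"
    using geometric_action_coarsely_dense[OF geometric] by meson
  \<comment> \<open>The combing axiom asks for a positive bound, hence
    \<open>max D 1\<close>.\<close>
  obtain C1 where C1: "\<And>y y' n n'. dist y y' \<le> max D 1 \<Longrightarrow> \<bar>real n - real n'\<bar> \<le> max D 1 \<Longrightarrow>
      dist (S' y n) (S' y' n') \<le> C1"
    using combing[unfolded combing_def] by (meson UNIV_I less_max_iff_disj zero_less_one)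
  obtain C2 where C2: "\<And>g n. g \<in> carrier G \<Longrightarrow>
      dist (\<phi> (\<beta> (proj p (real n) (\<phi> g p))) x0) (S' (\<phi> g x0) n) \<le> C2"
    using morphism
    by (auto simp: combing_morphism_def transported_combing_def bicombing_combing_def proj_def)
  obtain C3 where C3: "\<And>y. dist (\<phi> (\<beta> y) p) y \<le> C3" and \<beta>: "\<And>y. \<beta> y \<in> carrier G"
    using quasi_inverse by (auto simp: quasi_inverse_def)
  \<comment> \<open>The summands follow a chain: x is moved to a nearby orbit point g x0 (C1), the
    morphism leads to \<beta> of a projection acting on x0 (C2), x0 is exchanged for p, the
    quasi-inverse returns the projection of g p (C3), g p is moved back to x, and the basepoint p is
    changed to q.\<close>
  have "dist (S' x n) (proj q (real n) x) \<le>
      C1 + C2 + dist x0 p + C3 + 2 * (dist p x0 + D) + 2 * dist p q" for x n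
  proof -
    obtain g where g: "g \<in> carrier G" "dist x (\<phi> g x0) \<le> D" using D by blast
    let ?y = "proj p (real n) (\<phi> g p)"
    have "dist (S' x n) (S' (\<phi> g x0) n) \<le> C1" using C1 g(2) by simp
    moreover have "dist (S' (\<phi> g x0) n) (\<phi> (\<beta> ?y) x0) \<le> C2" using C2[OF g(1)] by (simp add: dist_commute)
    moreover have "dist (\<phi> (\<beta> ?y) x0) (\<phi> (\<beta> ?y) p) = dist x0 p" using iso[OF \<beta>] .
    moreover have "dist (\<phi> (\<beta> ?y) p) ?y \<le> C3" by (rule C3)
    moreover have "dist ?y (proj p (real n) x) \<le> 2 * (dist p x0 + D)"
      using dist_proj_proj_le[of "real n" p "\<phi> g p" x] dist_triangle[of "\<phi> g p" x "\<phi> g x0"]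
        iso[OF g(1), of p x0] g(2) by (simp add: dist_commute)
    moreover have "dist (proj p (real n) x) (proj q (real n) x) \<le> 2 * dist p q"
      by (rule dist_proj_basepoint_le) simp
    moreover note dist_triangle[of "S' x n" "proj q (real n) x" "S' (\<phi> g x0) n"]
      dist_triangle[of "S' (\<phi> g x0) n" "proj q (real n) x" "\<phi> (\<beta> ?y) x0"]
      dist_triangle[of "\<phi> (\<beta> ?y) x0" "proj q (real n) x" "\<phi> (\<beta> ?y) p"]
      dist_triangle[of "\<phi> (\<beta> ?y) p" "proj q (real n) x" ?y]
      dist_triangle[of ?y "proj q (real n) x" "proj p (real n) x"]
    ultimately show ?thesis by linarith
  qed
  moreover have "\<exists>N. \<forall>n\<ge>N. \<forall>x. dist q x \<le> R \<longrightarrow> S' x n = x" for R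
  proof -
    \<comment> \<open>The ball about q is enclosed in one about b, the basepoint of the given
      combing; the maximum with 0 allows negative R.\<close>
    have "0 \<le> max 0 (dist b q + R)" by simp
    then obtain N where N: "\<forall>n\<ge>N. \<forall>y\<in>UNIV. dist b y \<le> max 0 (dist b q + R) \<longrightarrow> S' y n = y"
      using combing[unfolded combing_def] by meson
    have "S' x n = x" if "N \<le> n" "dist q x \<le> R" for n x
      using N that dist_triangle[of b x q] by auto
    then show ?thesis by blast
  qed
  ultimately have "tracks q S'" unfolding tracks_def by blast
  then have A: "combing_algebra S' = combing_algebra (bicombing_combing \<sigma> q)"
    by (rule combing_algebra_tracks)
  have "gelfand_map q (sigma_act \<phi> \<sigma> g z) =
      gelfand_act \<phi> (combing_algebra (bicombing_combing \<sigma> q)) g (gelfand_map q z)"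
    if g: "g \<in> carrier G" and z: "z \<in> sigma_bar \<sigma>" for g z
  proof -
    interpret bicombed_isometry \<sigma> "\<phi> g"
      using iso[OF g] equivariant[OF g] by unfold_locales
    have "extend q f (sigma_act \<phi> \<sigma> g z) = extend q (f \<circ> \<phi> g) z"
      if "f \<in> combing_algebra (bicombing_combing \<sigma> q)" for f
      using extend_class_ray_image[OF that] z by (cases z) (auto simp: sigma_bar_def)
    then show ?thesis
      using combing_algebra_isometry by (auto simp: gelfand_map_def gelfand_act_def intro!: restrict_ext)
  qed
  then show ?thesis
    unfolding A using homeomorphic_map_gelfand_map gelfand_map_Inl by blast
qed

end
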